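(* Let $\mathcal{X}\subseteq\mathbb{R}^d$ be a nonempty bounded polytope and $\mathcal{C}=\{c\in\mathbb{R}^d:(c-c_0)^\top\Sigma^{-1}(c-c_0)\le1\}$ with $\Sigma\succ0$, $c_0\in\mathbb{R}^d$. Let $(\xi,c)\sim P$ with $\xi\in\Xi\subseteq\mathbb{R}^p$ and $c\in\mathcal{C}$ almost surely. Let $\mathcal{D}$ be a minimal-size global sufficient decision dataset for $(\mathcal{X},\mathcal{C})$, $W_\star:=\operatorname{span}(\mathcal{D})$, $d^\star:=\dim W_\star$, $U_\star\in\mathbb{R}^{d\times d^\star}$ an orthonormal basis of $W_\star$, and $\mathcal{L}_{U_\star}:=\Sigma U_\star(U_\star^\top\Sigma U_\star)^{-1}$. Define $$\mathcal{H}_{U_\star,d^\star}:=\{f_B(\xi)=c_0+\mathcal{L}_{U_\star}B\xi:\ B\in\mathbb{R}^{d^\star\times p}\},$$ $$\mathcal{H}(\mathcal{C}):=\{f_A(\xi)=c_0+A\xi:\ A\in\mathbb{R}^{d\times p},\ f_A(\xi)\in\mathcal{C}\text{ a.s.}\},\qquad \mathcal{H}_{U_\star,d^\star}(\mathcal{C}):=\{f\in\mathcal{H}_{U_\star,d^\star}:\ f(\xi)\in\mathcal{C}\text{ a.s.}\}.$$ (1) (No misspecification loss.) Let $f_\star\in\operatorname{argmin}_{f\in\mathcal{H}(\mathcal{C})}R_{\mathrm{SPO}}(f)$ and define its compressed version $\hat f_\star(\xi):=c_0+\mathcal{L}_{U_\star}U_\star^\top(f_\star(\xi)-c_0)\in\mathcal{H}_{U_\star,d^\star}(\mathcal{C})$.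 Then $\hat f_\star\in\operatorname{argmin}_{f\in\mathcal{H}_{U_\star,d^\star}(\mathcal{C})}R_{\mathrm{SPO}}(f)$ and $R_{\mathrm{SPO}}(f_\star)=R_{\mathrm{SPO}}(\hat f_\star)$. (2) (Generalization bound in the compressed class.) For any $\delta\in(0,1)$, with probability at least $1-\delta$ over an i.i.d. sample $S=\{(\xi_i,c_i)\}_{i=1}^n\sim P$, the following holds simultaneously for all $f\in\mathcal{H}_{U_\star,d^\star}$: $$R_{\mathrm{SPO}}(f)\le\hat R_{\mathrm{SPO}}(f)+2\,\omega_{\mathcal{X}}(\mathcal{C})\sqrt{\frac{2(d^\star p+1)\log(n|\mathcal{X}^\angle|^2)}{n}}+\omega_{\mathcal{X}}(\mathcal{C})\sqrt{\frac{\log(1/\delta)}{2n}}.$$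
   Context: $\mathcal{X}^\angle$ is the set of extreme points of $\mathcal{X}$. $x^\star:\mathbb{R}^d\to\mathcal{X}^\angle$ is a fixed deterministic oracle with $x^\star(v)\in\operatorname{argmin}_{x\in\mathcal{X}}v^\top x$ for all $v$, obtained by a deterministic tie-breaking rule applied to the optimal set (e.g. lexicographic), so $x^\star(v)$ is determined by $\operatorname{argmin}_{x\in\mathcal{X}}v^\top x$. A dataset $\mathcal{D}=\{q_1,\dots,q_l\}\subseteq\mathbb{R}^d$ is a global sufficient decision dataset for $(\mathcal{X},\mathcal{C})$ if there is a map $\widehat X:\mathbb{R}^l\to\mathcal{P}(\mathcal{X})$ (subsets of $\mathcal{X}$) with $\widehat X(c^\top q_1,\dots,c^\top q_l)=\operatorname{argmin}_{x\in\mathcal{X}}c^\top x$ for all $c\in\mathcal{C}$. SPO loss: $\ell_{\mathrm{SPO}}(\hat c,c):=c^\top x^\star(\hat c)-c^\top x^\star(c)$. SPO risk: $R_{\mathrm{SPO}}(f):=\mathbb{E}_{(\xi,c)\sim P}[\ell_{\mathrm{SPO}}(f(\xi),c)]$; empirical SPO risk: $\hat R_{\mathrm{SPO}}(f):=\frac1n\sum_{i=1}^n\ell_{\mathrm{SPO}}(f(\xi_i),c_i)$. Range constant: $\omega_{\mathcal{X}}(\mathcal{C}):=\sup_{c\in\mathcal{C}}\bigl(\max_{x\in\mathcal{X}}c^\top x-\min_{x\in\mathcal{X}}c^\top x\bigr)$. *)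

theory Defs
  imports "HOL-Probability.Probability"
begin

definition argmin_on :: "('a \<Rightarrow> real) \<Rightarrow> 'a set \<Rightarrow> 'a set" where
  "argmin_on f A = {x. is_arg_min f (\<lambda>y. y \<in> A) x}"

definition lin_argmin :: "(real ^ 'd) set \<Rightarrow> real ^ 'd \<Rightarrow> (real ^ 'd) set" where
  "lin_argmin X c = argmin_on (\<lambda>x. c \<bullet> x) X"

definition extreme_points :: "(real ^ 'd) set \<Rightarrow> (real ^ 'd) set" where
  "extreme_points X = {x. x extreme_point_of X}"

text \<open>The witness \<open>tie\<close> is the deterministic tie-breaking rule: the selected point
  depends on the cost vector only through the set of optimal solutions.\<close>

definition lp_oracle :: "(real ^ 'd) set \<Rightarrow> (real ^ 'd \<Rightarrow> real ^ 'd) \<Rightarrow> bool" where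
  "lp_oracle X xs \<longleftrightarrow>
     (\<forall>v. xs v \<in> lin_argmin X v \<inter> extreme_points X) \<and>
     (\<exists>tie. \<forall>v. xs v = tie (lin_argmin X v))"

definition pos_def :: "real ^ 'd ^ 'd \<Rightarrow> bool" where
  "pos_def A \<longleftrightarrow> transpose A = A \<and> (\<forall>x. x \<noteq> 0 \<longrightarrow> 0 < x \<bullet> (A *v x))"

definition ellipsoid :: "real ^ 'd \<Rightarrow> real ^ 'd ^ 'd \<Rightarrow> (real ^ 'd) set" where
  "ellipsoid c0 Sig = {c. (c - c0) \<bullet> (matrix_inv Sig *v (c - c0)) \<le> 1}"

text \<open>A dataset \<open>q\<^sub>1, \<dots>, q\<^sub>l\<close> is a list of length \<open>l\<close>, and \<open>\<real>\<^sup>l\<close> is rendered as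
  the real lists of length \<open>l\<close>. A list of minimal length has no repetitions, so that
  minimal lists are the enumerations of the minimal sets.\<close>

definition suff_dataset :: "(real ^ 'd) set \<Rightarrow> (real ^ 'd) set \<Rightarrow> (real ^ 'd) list \<Rightarrow> bool" where
  "suff_dataset X C qs \<longleftrightarrow>
     (\<exists>Xhat :: real list \<Rightarrow> (real ^ 'd) set.
        (\<forall>y. length y = length qs \<longrightarrow> Xhat y \<subseteq> X) \<and>
        (\<forall>c\<in>C. Xhat (map (\<lambda>q. c \<bullet> q) qs) = lin_argmin X c))"

definition min_suff_dataset :: "(real ^ 'd) set \<Rightarrow> (real ^ 'd) set \<Rightarrow> (real ^ 'd) list \<Rightarrow> bool" where
  "min_suff_dataset X C qs \<longleftrightarrow> is_arg_min length (suff_dataset X C) qs"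

text \<open>The number \<open>k\<close> of columns of the basis matrix depends on the data and may be \<open>0\<close>, which
  rules out a finite index type. A \<open>d \<times> k\<close> matrix is therefore given by its columns
  \<open>U 0, \<dots>, U (k - 1)\<close>, a \<open>k \<times> p\<close> matrix by its rows, and a \<open>k \<times> k\<close> matrix by its entries.
  Values at indices \<open>\<ge> k\<close> are never used.\<close>

definition orthonormal_basis :: "nat \<Rightarrow> (nat \<Rightarrow> real ^ 'd) \<Rightarrow> (real ^ 'd) set \<Rightarrow> bool" where
  "orthonormal_basis k U W \<longleftrightarrow>
     (\<forall>i<k. \<forall>j<k. U i \<bullet> U j = (if i = j then 1 else 0)) \<and> span (U ` {..<k}) = W"

text \<open>Analogue of \<^const>\<open>matrix_inv\<close> for \<open>k \<times> k\<close> matrices.\<close>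

definition sq_inv :: "nat \<Rightarrow> (nat \<Rightarrow> nat \<Rightarrow> real) \<Rightarrow> nat \<Rightarrow> nat \<Rightarrow> real" where
  "sq_inv k G = (SOME H. \<forall>i<k. \<forall>j<k.
     (\<Sum>l<k. G i l * H l j) = (if i = j then 1 else 0) \<and>
     (\<Sum>l<k. H i l * G l j) = (if i = j then 1 else 0))"

text \<open>Column \<open>j\<close> of the \<open>d \<times> k\<close> matrix \<open>\<Sigma> U (U\<^sup>T \<Sigma> U)\<^sup>-\<^sup>1\<close>.\<close>

definition lift_col :: "real ^ 'd ^ 'd \<Rightarrow> nat \<Rightarrow> (nat \<Rightarrow> real ^ 'd) \<Rightarrow> nat \<Rightarrow> real ^ 'd" where
  "lift_col Sig k U j =
     (\<Sum>i<k. sq_inv k (\<lambda>a b. U a \<bullet> (Sig *v U b)) i j *\<^sub>R (Sig *v U i))"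

definition lift_map :: "real ^ 'd ^ 'd \<Rightarrow> nat \<Rightarrow> (nat \<Rightarrow> real ^ 'd) \<Rightarrow> (nat \<Rightarrow> real) \<Rightarrow> real ^ 'd" where
  "lift_map Sig k U y = (\<Sum>j<k. y j *\<^sub>R lift_col Sig k U j)"

definition full_class :: "real ^ 'd \<Rightarrow> (real ^ 'p \<Rightarrow> real ^ 'd) set" where
  "full_class c0 = {f. \<exists>A :: real ^ 'p ^ 'd. f = (\<lambda>\<xi>. c0 + A *v \<xi>)}"

definition compressed_class ::
  "real ^ 'd \<Rightarrow> real ^ 'd ^ 'd \<Rightarrow> nat \<Rightarrow> (nat \<Rightarrow> real ^ 'd) \<Rightarrow> (real ^ 'p \<Rightarrow> real ^ 'd) set" where
  "compressed_class c0 Sig k U =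
     {f. \<exists>B :: nat \<Rightarrow> real ^ 'p. f = (\<lambda>\<xi>. c0 + lift_map Sig k U (\<lambda>i. B i \<bullet> \<xi>))}"

definition feasible_in ::
  "((real ^ 'p) \<times> (real ^ 'd)) measure \<Rightarrow> (real ^ 'd) set \<Rightarrow>
   (real ^ 'p \<Rightarrow> real ^ 'd) set \<Rightarrow> (real ^ 'p \<Rightarrow> real ^ 'd) set" where
  "feasible_in P C H = {f \<in> H. AE z in P. f (fst z) \<in> C}"

definition compress ::
  "real ^ 'd \<Rightarrow> real ^ 'd ^ 'd \<Rightarrow> nat \<Rightarrow> (nat \<Rightarrow> real ^ 'd) \<Rightarrow>
   (real ^ 'p \<Rightarrow> real ^ 'd) \<Rightarrow> real ^ 'p \<Rightarrow> real ^ 'd" where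
  "compress c0 Sig k U f = (\<lambda>\<xi>. c0 + lift_map Sig k U (\<lambda>i. U i \<bullet> (f \<xi> - c0)))"

definition spo_loss :: "(real ^ 'd \<Rightarrow> real ^ 'd) \<Rightarrow> real ^ 'd \<Rightarrow> real ^ 'd \<Rightarrow> real" where
  "spo_loss xs chat c = c \<bullet> xs chat - c \<bullet> xs c"

definition spo_risk ::
  "(real ^ 'd \<Rightarrow> real ^ 'd) \<Rightarrow> ((real ^ 'p) \<times> (real ^ 'd)) measure \<Rightarrow>
   (real ^ 'p \<Rightarrow> real ^ 'd) \<Rightarrow> real" where
  "spo_risk xs P f = (\<integral>z. spo_loss xs (f (fst z)) (snd z) \<partial>P)"

definition emp_spo_risk ::
  "(real ^ 'd \<Rightarrow> real ^ 'd) \<Rightarrow> nat \<Rightarrow> (nat \<Rightarrow> (real ^ 'p) \<times> (real ^ 'd)) \<Rightarrow>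
   (real ^ 'p \<Rightarrow> real ^ 'd) \<Rightarrow> real" where
  "emp_spo_risk xs n S f = (\<Sum>i<n. spo_loss xs (f (fst (S i))) (snd (S i))) / real n"

definition lp_range :: "(real ^ 'd) set \<Rightarrow> (real ^ 'd) set \<Rightarrow> real" where
  "lp_range X C = (SUP c\<in>C. (SUP x\<in>X. c \<bullet> x) - (INF x\<in>X. c \<bullet> x))"

text \<open>The event that a bound holds uniformly over an uncountable class need not be in the
  sigma-algebra, where \<^const>\<open>measure\<close> would return \<open>0\<close>. Holding with probability \<open>\<ge> r\<close>
  therefore means that there is a measurable event of probability at least \<open>r\<close> on which the property holds.\<close>

definition with_prob_ge :: "'a measure \<Rightarrow> real \<Rightarrow> ('a \<Rightarrow> bool) \<Rightarrow> bool" where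
  "with_prob_ge M r Q \<longleftrightarrow> (\<exists>E\<in>sets M. r \<le> measure M E \<and> (\<forall>S\<in>E. Q S))"

end

theory Submission imports Defs
begin

text \<open>
  \<^bold>\<open>No misspecification loss.\<close> The columns of \<open>L = \<Sigma> U (U\<^sup>T \<Sigma> U)\<^sup>-\<^sup>1\<close> lie in \<open>\<Sigma> W\<close>, and \<open>U\<^sup>T L\<close> is
  the identity. Hence \<open>L U\<^sup>T\<close> is the orthogonal projection onto \<open>\<Sigma> W\<close> for the inner product given by
  \<open>\<Sigma>\<^sup>-\<^sup>1\<close>: compressing a cost vector keeps its products with all of \<open>W\<close>, in particular with the
  dataset (\<open>compressed_inner\<close>), and it does not increase the Mahalanobis distance to \<open>c\<^sub>0\<close>, so that it
  stays in the ellipsoid (\<open>compressed_in_ellipsoid\<close>). By sufficiency of the dataset a cost vector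
  in the ellipsoid and its compression have the same set of optimal solutions, hence the same
  decision. Compression therefore preserves the risk, and since the compressed class is contained in
  the full class, it carries a minimizer to a minimizer.

  \<^bold>\<open>Generalization.\<close> A compressed predictor is \<open>c\<^sub>0 + A \<xi>\<close> with \<open>A\<close> in a space of matrices of
  dimension at most \<open>D = d\<^sup>\<star> p\<close>. Its decision at \<open>\<xi>\<close> depends only on the signs of
  \<open>(c\<^sub>0 + A \<xi>) \<bullet> (e - e')\<close> for pairs of extreme points, which are affine functions of \<open>A\<close>, and \<open>N\<close>
  affine functions take at most \<open>(2 N + 1)\<^sup>D\<close> sign patterns, zeros included
  (\<open>card_sign_patterns\<close>). So the class has few loss vectors on a double sample of \<open>2 n\<close> points. The
  expected supremum of the difference between the two halves is then small, by random swaps of the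
  halves and the maximal inequality for finitely many sub-Gaussian variables
  (\<open>expectation_sup_gap_le\<close>), and the bounded differences inequality gives concentration around that
  expectation with the sharp constant in the confidence term (\<open>uniform_deviation_bound\<close>).

  \<^bold>\<open>Measurability.\<close> The supremum over all predictors of the risk minus the empirical risk is never
  treated as a random variable. It is dominated, at every sample, by the conditional expectation of the supremum over the
  double sample, and this second supremum is measurable: it is attained among finitely many patterns
  of decisions, the cost vectors with a given decision form an \<open>F\<^sub>\<sigma>\<close> set, and the samples
  for which some parameter realizes a given pattern are the projection of such a set along a
  \<open>\<sigma>\<close>-compact parameter space (\<open>sets_Ex_fsigma\<close>). Since decisions at ties matter, a
  parameter on a lower-dimensional cell cannot be replaced by a nearby one, and a countable dense set
  of parameters would not suffice.
\<close>

section \<open>Sign patterns of affine functions\<close>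

lemma sgn_eq_convex_combination:
  fixes u v t :: real
  assumes "sgn u = s" "sgn v = s" "0 \<le> t" "t \<le> 1"
  shows "sgn ((1 - t) * u + t * v) = s"
proof -
  consider "u > 0" "v > 0" | "u = 0" "v = 0" | "u < 0" "v < 0"
    using assms(1,2) by (metis sgn_less sgn_greater linorder_neqE_linordered_idom sgn_0)
  then show ?thesis
  proof cases
    case 1
    have "(1 - t) * u + t * v > 0"
    proof (cases "t = 0")
      case False
      have "t * v > 0" "(1 - t) * u \<ge> 0" using False 1 assms(3,4) by auto
      then show ?thesis by linarith
    qed (use 1 in auto)
    then show ?thesis using 1 assms by simp
  next
    case 2
    then show ?thesis using assms by auto
  next
    case 3
    have "(1 - t) * u + t * v < 0"
    proof (cases "t = 0")
      case False
      have "t * v < 0" "(1 - t) * u \<le> 0"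
        using False 3 assms(3,4) by (auto intro: mult_pos_neg simp: mult_nonneg_nonpos)
      then show ?thesis by linarith
    qed (use 3 in auto)
    then show ?thesis using 3 assms by simp
  qed
qed

lemma sgn_real_values: "sgn (x::real) \<in> {-1, 0, 1}"
  by (cases x "0::real" rule: linorder_cases) auto

text \<open>If the value of \<open>g\<close> determines that of \<open>f\<close>, then \<open>f\<close> factors through \<open>g\<close>.\<close>
lemma card_image_le_of_refines:
  assumes "finite (g ` S)" "\<And>x y. x \<in> S \<Longrightarrow> y \<in> S \<Longrightarrow> g x = g y \<Longrightarrow> f x = f y"
  shows "finite (f ` S)" and "card (f ` S) \<le> card (g ` S)"
proof -
  define h where "h q = f (SOME x. x \<in> S \<and> g x = q)" for q
  have "f x = h (g x)" if "x \<in> S" for x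
  proof -
    have "(SOME y. y \<in> S \<and> g y = g x) \<in> S \<and> g (SOME y. y \<in> S \<and> g y = g x) = g x"
      by (rule someI[of _ x]) (use that in auto)
    then show ?thesis using assms(2) that by (metis h_def)
  qed
  then have *: "f ` S = h ` (g ` S)" by (auto simp: image_image)
  show "finite (f ` S)" "card (f ` S) \<le> card (g ` S)"
    unfolding * using assms(1) by (auto intro: card_image_le)
qed

definition sign_pattern :: "('j \<Rightarrow> 'a::real_inner) \<Rightarrow> ('j \<Rightarrow> real) \<Rightarrow> 'j set \<Rightarrow> 'a \<Rightarrow> 'j \<Rightarrow> real" where
  "sign_pattern b a J x = (\<lambda>j\<in>J. sgn (b j \<bullet> x - a j))"

lemma finite_sign_patterns: "finite J \<Longrightarrow> finite (sign_pattern b a J ` S)"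
proof -
  assume "finite J"
  then have "finite (PiE J (\<lambda>_. {-1, 0, 1::real}))" by (intro finite_PiE) auto
  moreover have "sign_pattern b a J ` S \<subseteq> PiE J (\<lambda>_. {-1, 0, 1::real})"
    unfolding sign_pattern_def
    by (intro image_subsetI restrict_PiE_iff[THEN iffD2] ballI sgn_real_values)
  ultimately show ?thesis by (rule finite_subset[rotated])
qed

text \<open>Points with a given pattern on \<open>J\<close> form a convex set. A further affine function has constant
  sign on it unless it vanishes somewhere there, and then it adds at most two new patterns. The
  patterns of the second kind are those that occur on the hyperplane.\<close>
lemma card_sign_patterns_insert:
  fixes S :: "'a::real_inner set"
  assumes J: "finite J" "j \<notin> J" and S: "convex S"
  shows "card (sign_pattern b a (insert j J) ` S)
    \<le> card (sign_pattern b a J ` S) + 2 * card (sign_pattern b a J ` (S \<inter> {x. b j \<bullet> x = a j}))"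
proof -
  define p where "p = sign_pattern b a J"
  define h where "h x = sgn (b j \<bullet> x - a j)" for x
  define Z where "Z = p ` (S \<inter> {x. b j \<bullet> x = a j})"
  have pp: "p x i = sgn (b i \<bullet> x - a i)" if "i \<in> J" for x i
    using that by (simp add: p_def sign_pattern_def)
  have fin: "finite (p ` S)" using finite_sign_patterns[OF J(1)] by (simp add: p_def)
  have ZS: "Z \<subseteq> p ` S" by (auto simp: Z_def)
  have eq: "p x = p y" if "\<And>i. i \<in> J \<Longrightarrow> sgn (b i \<bullet> x - a i) = sgn (b i \<bullet> y - a i)" for x y
    using that by (auto simp: p_def sign_pattern_def fun_eq_iff)
  have "card (sign_pattern b a (insert j J) ` S) \<le> card ((\<lambda>x. (p x, h x)) ` S)"
  proof (rule card_image_le_of_refines)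
    show "finite ((\<lambda>x. (p x, h x)) ` S)"
      by (rule finite_subset[of _ "p ` S \<times> {-1,0,1}"]) (use fin sgn_real_values in \<open>auto simp: h_def simp del: insert_iff\<close>)
    fix x y assume "(p x, h x) = (p y, h y)"
    then show "sign_pattern b a (insert j J) x = sign_pattern b a (insert j J) y"
      using pp[of _ x] pp[of _ y] by (auto simp: sign_pattern_def h_def fun_eq_iff)
  qed
  also have "(\<lambda>x. (p x, h x)) ` S = (SIGMA q:p ` S. h ` {x\<in>S. p x = q})"
    by (auto simp: image_iff; metis)
  also have "card \<dots> = (\<Sum>q\<in>p ` S. card (h ` {x\<in>S. p x = q}))"
  proof (rule card_SigmaI[OF fin], rule ballI)
    fix q show "finite (h ` {x \<in> S. p x = q})"
      by (rule finite_subset[of _ "{-1,0,1}"]) (auto simp: h_def sgn_real_def)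
  qed
  also have "\<dots> \<le> (\<Sum>q\<in>p ` S. 1 + 2 * of_bool (q \<in> Z))"
  proof (rule sum_mono)
    fix q assume "q \<in> p ` S"
    show "card (h ` {x\<in>S. p x = q}) \<le> 1 + 2 * of_bool (q \<in> Z)"
    proof (cases "q \<in> Z")
      case True
      have "card (h ` {x\<in>S. p x = q}) \<le> card {-1, 0, 1::real}"
        by (rule card_mono) (auto simp: h_def sgn_real_def)
      then show ?thesis using True by simp
    next
      case False
      have same: "h x = h y" if x: "x \<in> S" "p x = q" and y: "y \<in> S" "p y = q"
        and less: "b j \<bullet> x \<le> b j \<bullet> y" for x y
      proof -
        define u v where "u = b j \<bullet> x - a j" and "v = b j \<bullet> y - a j"
        have "b j \<bullet> z \<noteq> a j" if "z \<in> S" "p z = q" for z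
          using False that by (force simp: Z_def)
        then have nz: "u \<noteq> 0" "v \<noteq> 0" using x y by (auto simp: u_def v_def)
        have "\<not> (u < 0 \<and> v > 0)"
        proof
          assume uv: "u < 0 \<and> v > 0"
          \<comment> \<open>The segment from \<open>x\<close> to \<open>y\<close> crosses the new hyperplane at parameter \<open>t\<close>.\<close>
          define t where "t = - u / (v - u)"
          have t: "0 \<le> t" "t \<le> 1" using uv by (auto simp: t_def divide_simps)
          define w where "w = (1 - t) *\<^sub>R x + t *\<^sub>R y"
          have w: "w \<in> S" unfolding w_def using S x y t by (simp add: convex_alt)
          have wi: "b i \<bullet> w - a i = (1 - t) * (b i \<bullet> x - a i) + t * (b i \<bullet> y - a i)" for i
            by (simp add: w_def inner_add_right algebra_simps)
          have "p w = p x"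
          proof (rule eq)
            fix i assume i: "i \<in> J"
            have "sgn (b i \<bullet> y - a i) = sgn (b i \<bullet> x - a i)"
              using pp[OF i, of x] pp[OF i, of y] x y by simp
            then show "sgn (b i \<bullet> w - a i) = sgn (b i \<bullet> x - a i)"
              unfolding wi using t by (intro sgn_eq_convex_combination) auto
          qed
          moreover have "b j \<bullet> w = a j"
          proof -
            have "(1 - t) * u + t * v = 0"
              using uv unfolding t_def by (simp add: field_simps)
            then show ?thesis using wi[of j] by (simp add: u_def v_def)
          qed
          ultimately have "q \<in> Z" using w x unfolding Z_def by auto
          then show False using False by simp
        qed
        then show ?thesis using nz less unfolding h_def u_def v_def
          by (auto simp: sgn_real_def split: if_splits)
      qed
      have "card (h ` {x\<in>S. p x = q}) \<le> card ((\<lambda>x. ()) ` {x\<in>S. p x = q})"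
      proof (rule card_image_le_of_refines)
        fix x y assume "x \<in> {x\<in>S. p x = q}" "y \<in> {x\<in>S. p x = q}"
        then show "h x = h y" using same[of x y] same[of y x] by fastforce
      qed (rule finite_subset[of _ "{()}"], auto)
      also have "\<dots> \<le> card {()}" by (rule card_mono) auto
      finally show ?thesis using False by simp
    qed
  qed
  also have "\<dots> = card (p ` S) + 2 * card Z"
  proof -
    have "(\<Sum>q\<in>p ` S. of_bool (q \<in> Z)) = card (p ` S \<inter> Z)"
      using fin by (simp add: Int_def)
    moreover have "p ` S \<inter> Z = Z" using ZS by auto
    moreover have "(\<Sum>q\<in>p ` S. 1 + 2 * of_bool (q \<in> Z))
        = card (p ` S) + 2 * (\<Sum>q\<in>p ` S. of_bool (q \<in> Z))"
      by (simp only: sum.distrib sum_distrib_left card_eq_sum)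
    ultimately show ?thesis by simp
  qed
  finally show ?thesis by (simp add: p_def Z_def)
qed

text \<open>This counts the faces of all dimensions of a hyperplane arrangement. A new hyperplane meets
  \<open>S\<close> in a space of smaller dimension, so the count \<open>F(N, D)\<close> satisfies
  \<open>F(N + 1, D) \<le> F(N, D) + 2 F(N, D - 1)\<close>, and \<open>(2 N + 1)\<^sup>D\<close> solves this recursion.\<close>
lemma card_sign_patterns:
  fixes S :: "'a::euclidean_space set"
  assumes "finite J" "affine S" "aff_dim S \<le> int D"
  shows "card (sign_pattern b a J ` S) \<le> (2 * card J + 1) ^ D"
  using assms
proof (induction J arbitrary: S D rule: finite_induct)
  case empty
  have "card (sign_pattern b a {} ` S) \<le> card {\<lambda>_::'b. undefined :: real}"
    by (rule card_mono) (auto simp: sign_pattern_def)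
  then show ?case by simp
next
  case (insert j J)
  define H where "H = {x. b j \<bullet> x = a j}"
  have dimH: "aff_dim (S \<inter> H) = (if S \<inter> H = {} then -1 else if S \<subseteq> H then aff_dim S else aff_dim S - 1)"
    unfolding H_def by (rule aff_dim_affine_Int_hyperplane[OF insert.prems(1)])
  show ?case
  proof (cases "S \<subseteq> H")
    case True
    have "card (sign_pattern b a (insert j J) ` S) \<le> card (sign_pattern b a J ` S)"
    proof (rule card_image_le_of_refines)
      show "finite (sign_pattern b a J ` S)" by (rule finite_sign_patterns) fact
      fix x y assume xy: "x \<in> S" "y \<in> S" and e: "sign_pattern b a J x = sign_pattern b a J y"
      have "sgn (b i \<bullet> x - a i) = sgn (b i \<bullet> y - a i)" if "i \<in> J" for i
        using fun_cong[OF e, of i] that by (simp add: sign_pattern_def)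
      moreover have "b j \<bullet> x - a j = 0" "b j \<bullet> y - a j = 0" using True xy by (auto simp: H_def)
      ultimately show "sign_pattern b a (insert j J) x = sign_pattern b a (insert j J) y"
        by (auto simp: sign_pattern_def fun_eq_iff)
    qed
    also have "\<dots> \<le> (2 * card J + 1) ^ D" by (rule insert.IH) fact+
    also have "\<dots> \<le> (2 * card (insert j J) + 1) ^ D"
      using insert.hyps by (intro power_mono) auto
    finally show ?thesis .
  next
    case False
    show ?thesis
    proof (cases D)
      case 0
      then have "aff_dim S \<le> 0" using insert.prems by simp
      then have "S = {} \<or> (\<exists>x. S = {x})"
        using aff_dim_eq_0 aff_dim_geq[of S] aff_dim_empty
        by (metis aff_dim_negative_iff linorder_not_le order_antisym)
      then show ?thesis using 0 by auto
    next
      case (Suc D')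
      have "card (sign_pattern b a (insert j J) ` S)
        \<le> card (sign_pattern b a J ` S) + 2 * card (sign_pattern b a J ` (S \<inter> H))"
        unfolding H_def by (rule card_sign_patterns_insert)
          (use insert in \<open>auto intro: affine_imp_convex\<close>)
      also have "card (sign_pattern b a J ` S) \<le> (2 * card J + 1) ^ D"
        by (rule insert.IH) fact+
      also have "card (sign_pattern b a J ` (S \<inter> H)) \<le> (2 * card J + 1) ^ D'"
      proof (rule insert.IH)
        show "affine (S \<inter> H)" unfolding H_def
          by (intro affine_Int affine_hyperplane insert.prems)
        show "aff_dim (S \<inter> H) \<le> int D'"
          using dimH False insert.prems Suc by (auto split: if_splits)
      qed
      also have "(2 * card J + 1) ^ D + 2 * (2 * card J + 1) ^ D'
          = (2 * card (insert j J) + 1) * (2 * card J + 1) ^ D'"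
        using insert.hyps by (simp add: Suc algebra_simps)
      also have "\<dots> \<le> (2 * card (insert j J) + 1) * (2 * card (insert j J) + 1) ^ D'"
        using insert.hyps by (intro mult_left_mono power_mono) auto
      finally show ?thesis using Suc by simp
    qed
  qed
qed

section \<open>The bounded differences inequality\<close>

text \<open>Hoeffding's lemma with the range replaced by the oscillation, since in the bounded differences
  inequality the interval that contains the values depends on the remaining coordinates.\<close>
lemma (in prob_space) Hoeffding_lemma_oscillation:
  fixes f :: "'a \<Rightarrow> real"
  assumes [measurable]: "f \<in> borel_measurable M" and l: "l > 0"
    and osc: "\<And>x y. x \<in> space M \<Longrightarrow> y \<in> space M \<Longrightarrow> f x - f y \<le> c"
  shows "(\<integral>\<^sup>+x. ennreal (exp (l * f x)) \<partial>M) \<le> ennreal (exp (l * expectation f + l\<^sup>2 * c\<^sup>2 / 8))"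
proof -
  define a where "a = (INF x\<in>space M. f x)"
  obtain x0 where x0: "x0 \<in> space M" using not_empty by auto
  have bdd: "bdd_below (f ` space M)"
    by (rule bdd_belowI[of _ "f x0 - c"]) (use osc[OF x0] in force)
  have range: "f x \<in> {a..a + c}" if x: "x \<in> space M" for x
  proof -
    have "a \<le> f x" unfolding a_def using bdd x by (rule cINF_lower)
    moreover have "f x - c \<le> a" unfolding a_def
      using x0 osc[OF x] by (intro cINF_greatest) (auto simp: algebra_simps)
    ultimately show ?thesis by auto
  qed
  interpret interval_bounded_random_variable M f a "a + c"
    by unfold_locales (use range in auto)
  define \<mu> where "\<mu> = expectation f"
  have "(\<integral>\<^sup>+x. ennreal (exp (l * f x)) \<partial>M)
      = (\<integral>\<^sup>+x. ennreal (exp (l * \<mu>)) * ennreal (exp (l * (f x - \<mu>))) \<partial>M)"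
    by (simp flip: ennreal_mult exp_add add: algebra_simps)
  also have "\<dots> = ennreal (exp (l * \<mu>)) * (\<integral>\<^sup>+x. ennreal (exp (l * (f x - \<mu>))) \<partial>M)"
    by (rule nn_integral_cmult) measurable
  also have "\<dots> \<le> ennreal (exp (l * \<mu>)) * ennreal (exp (l\<^sup>2 * (a + c - a)\<^sup>2 / 8))"
    unfolding \<mu>_def using Hoeffdings_lemma_nn_integral[OF l]
    by (intro mult_left_mono) (auto simp: algebra_simps)
  finally show ?thesis by (simp flip: ennreal_mult exp_add add: \<mu>_def)
qed

text \<open>McDiarmid's bound on the exponential moment, one coordinate at a time: integrating out a
  coordinate costs a factor \<open>exp (l\<^sup>2 c\<^sup>2 / 8)\<close> by Hoeffding's lemma, and the partial mean \<open>g\<close>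
  again has bounded differences.\<close>
theorem (in prob_space) bounded_differences_exp_moment:
  fixes f :: "('i \<Rightarrow> 'a) \<Rightarrow> real" and l :: real
  assumes "finite I" and "f \<in> borel_measurable (Pi\<^sub>M I (\<lambda>_. M))" and l: "l > 0"
    and "\<And>x. x \<in> space (Pi\<^sub>M I (\<lambda>_. M)) \<Longrightarrow> \<bar>f x\<bar> \<le> K"
    and "\<And>x i y. x \<in> space (Pi\<^sub>M I (\<lambda>_. M)) \<Longrightarrow> i \<in> I \<Longrightarrow> y \<in> space M \<Longrightarrow> \<bar>f x - f (x(i := y))\<bar> \<le> c"
  shows "(\<integral>\<^sup>+x. ennreal (exp (l * f x)) \<partial>Pi\<^sub>M I (\<lambda>_. M))
    \<le> ennreal (exp (l * (\<integral>x. f x \<partial>Pi\<^sub>M I (\<lambda>_. M)) + card I * l\<^sup>2 * c\<^sup>2 / 8))"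
  using assms(1,2,4,5)
proof (induction I arbitrary: f rule: finite_induct)
  interpret P: product_prob_space "\<lambda>_::'i. M" by unfold_locales
  {
    case empty
    have "Pi\<^sub>M {} (\<lambda>_::'i. M) = count_space {\<lambda>_. undefined}"
      by (rule measure_eqI_finite[of _ "{\<lambda>_. undefined}"]) (auto simp: sets_PiM_empty)
    then show ?case by (simp add: nn_integral_count_space_finite lebesgue_integral_count_space_finite)
  next
    case (insert i I)
    note [measurable] = insert.prems(1)
    interpret Q: prob_space "Pi\<^sub>M I (\<lambda>_::'i. M)" by (rule prob_space_PiM) unfold_locales
    interpret Q': prob_space "Pi\<^sub>M (insert i I) (\<lambda>_::'i. M)" by (rule prob_space_PiM) unfold_locales
    define g where "g x = (\<integral>y. f (x(i := y)) \<partial>M)" for x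
    have up: "x(i := y) \<in> space (Pi\<^sub>M (insert i I) (\<lambda>_. M))"
      if "x \<in> space (Pi\<^sub>M I (\<lambda>_. M))" "y \<in> space M" for x y
      using that insert.hyps by (auto simp: space_PiM PiE_def extensional_def Pi_def)
    have meas: "(\<lambda>y. f (x(i := y))) \<in> borel_measurable M"
      if "x \<in> space (Pi\<^sub>M I (\<lambda>_. M))" for x
      using that by measurable
    have int: "integrable M (\<lambda>y. f (x(i := y)))"
      if x: "x \<in> space (Pi\<^sub>M I (\<lambda>_. M))" for x
      by (rule integrable_const_bound[where B = K]) (use insert.prems(2) up[OF x] meas[OF x] in auto)
    have gm [measurable]: "g \<in> borel_measurable (Pi\<^sub>M I (\<lambda>_. M))"
      unfolding g_def by measurable
    have gK: "\<bar>g x\<bar> \<le> K" if x: "x \<in> space (Pi\<^sub>M I (\<lambda>_. M))" for x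
    proof -
      have "\<bar>g x\<bar> \<le> (\<integral>y. \<bar>f (x(i := y))\<bar> \<partial>M)" unfolding g_def by (rule integral_abs_bound)
      also have "\<dots> \<le> (\<integral>y. K \<partial>M)"
        by (rule integral_mono) (use int[OF x] insert.prems(2) up[OF x] in auto)
      finally show ?thesis by (simp add: prob_space)
    qed
    have gdiff: "\<bar>g x - g (x(j := z))\<bar> \<le> c"
      if x: "x \<in> space (Pi\<^sub>M I (\<lambda>_. M))" and j: "j \<in> I" and z: "z \<in> space M" for x j z
    proof -
      have x': "x(j := z) \<in> space (Pi\<^sub>M I (\<lambda>_. M))"
        using x j z by (auto simp: space_PiM PiE_def extensional_def Pi_def)
      have "\<bar>g x - g (x(j := z))\<bar> = \<bar>\<integral>y. f (x(i := y)) - f (x(j := z, i := y)) \<partial>M\<bar>"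
        unfolding g_def using int[OF x] int[OF x'] by simp
      also have "\<dots> \<le> (\<integral>y. \<bar>f (x(i := y)) - f (x(j := z, i := y))\<bar> \<partial>M)"
        by (rule integral_abs_bound)
      also have "\<dots> \<le> (\<integral>y. c \<partial>M)"
      proof (rule integral_mono)
        fix y assume y: "y \<in> space M"
        have "x(j := z, i := y) = x(i := y, j := z)"
          using insert.hyps j by (intro fun_upd_twist) auto
        then show "\<bar>f (x(i := y)) - f (x(j := z, i := y))\<bar> \<le> c"
          using insert.prems(3)[OF up[OF x y] insertI2[OF j] z] by (simp only:)
      qed (use int[OF x] int[OF x'] in auto)
      finally show ?thesis by (simp add: prob_space)
    qed
    have "(\<integral>\<^sup>+x. ennreal (exp (l * f x)) \<partial>Pi\<^sub>M (insert i I) (\<lambda>_. M))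
        = (\<integral>\<^sup>+x. \<integral>\<^sup>+y. ennreal (exp (l * f (x(i := y)))) \<partial>M \<partial>Pi\<^sub>M I (\<lambda>_. M))"
      by (rule P.product_nn_integral_insert) (use insert.hyps in auto)
    also have "\<dots> \<le> (\<integral>\<^sup>+x. ennreal (exp (l\<^sup>2 * c\<^sup>2 / 8)) * ennreal (exp (l * g x)) \<partial>Pi\<^sub>M I (\<lambda>_. M))"
    proof (rule nn_integral_mono)
      fix x assume x: "x \<in> space (Pi\<^sub>M I (\<lambda>_::'i. M))"
      have "(\<integral>\<^sup>+y. ennreal (exp (l * f (x(i := y)))) \<partial>M) \<le> ennreal (exp (l * g x + l\<^sup>2 * c\<^sup>2 / 8))"
        unfolding g_def
      proof (rule Hoeffding_lemma_oscillation[OF meas[OF x] l])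
        fix y z assume "y \<in> space M" "z \<in> space M"
        then show "f (x(i := y)) - f (x(i := z)) \<le> c"
          using abs_le_D1[OF insert.prems(3)[OF up[OF x] insertI1]] by (simp only: fun_upd_upd)
      qed
      then show "(\<integral>\<^sup>+y. ennreal (exp (l * f (x(i := y)))) \<partial>M)
          \<le> ennreal (exp (l\<^sup>2 * c\<^sup>2 / 8)) * ennreal (exp (l * g x))"
        by (simp flip: ennreal_mult exp_add add: add.commute)
    qed
    also have "\<dots> = ennreal (exp (l\<^sup>2 * c\<^sup>2 / 8)) * (\<integral>\<^sup>+x. ennreal (exp (l * g x)) \<partial>Pi\<^sub>M I (\<lambda>_. M))"
      by (rule nn_integral_cmult) measurable
    also have "\<dots> \<le> ennreal (exp (l\<^sup>2 * c\<^sup>2 / 8)) *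
        ennreal (exp (l * (\<integral>x. g x \<partial>Pi\<^sub>M I (\<lambda>_. M)) + card I * l\<^sup>2 * c\<^sup>2 / 8))"
      by (intro mult_left_mono insert.IH gm gK gdiff) auto
    also have "(\<integral>x. g x \<partial>Pi\<^sub>M I (\<lambda>_. M)) = (\<integral>x. f x \<partial>Pi\<^sub>M (insert i I) (\<lambda>_. M))"
    proof -
      have "integrable (Pi\<^sub>M (insert i I) (\<lambda>_. M)) f"
        by (rule Q'.integrable_const_bound[where B = K]) (use insert.prems(2) in auto)
      then show ?thesis unfolding g_def
        by (subst P.product_integral_insert) (use insert.hyps in auto)
    qed
    finally show ?case
      using insert.hyps by (simp flip: ennreal_mult exp_add add: algebra_simps add_divide_distrib)
  }
qed

theorem (in prob_space) bounded_differences_inequality: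
  fixes f :: "(nat \<Rightarrow> 'a) \<Rightarrow> real"
  assumes n: "n \<ge> 1" and [measurable]: "f \<in> borel_measurable (Pi\<^sub>M {..<n} (\<lambda>_. M))"
    and bound: "\<And>x. x \<in> space (Pi\<^sub>M {..<n} (\<lambda>_. M)) \<Longrightarrow> \<bar>f x\<bar> \<le> K"
    and diff: "\<And>x i y. x \<in> space (Pi\<^sub>M {..<n} (\<lambda>_. M)) \<Longrightarrow> i < n \<Longrightarrow> y \<in> space M
      \<Longrightarrow> \<bar>f x - f (x(i := y))\<bar> \<le> w / n"
    and w: "w > 0" and \<delta>: "0 < \<delta>" "\<delta> < 1"
  shows "1 - \<delta> \<le> measure (Pi\<^sub>M {..<n} (\<lambda>_. M)) {x \<in> space (Pi\<^sub>M {..<n} (\<lambda>_. M)).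
    f x < (\<integral>x. f x \<partial>Pi\<^sub>M {..<n} (\<lambda>_. M)) + w * sqrt (ln (1 / \<delta>) / (2 * real n))}"
proof -
  define Q where "Q = Pi\<^sub>M {..<n} (\<lambda>_. M)"
  interpret Q: prob_space Q unfolding Q_def by (rule prob_space_PiM) unfold_locales
  have [measurable]: "f \<in> borel_measurable Q" by (simp add: Q_def)
  define t where "t = w * sqrt (ln (1 / \<delta>) / (2 * real n))"
  \<comment> \<open>This choice minimizes the exponent \<open>- l t + l\<^sup>2 w\<^sup>2 / (8 n)\<close> of the Chernoff bound.\<close>
  define l where "l = 4 * n * t / w\<^sup>2"
  define \<mu> where "\<mu> = (\<integral>x. f x \<partial>Q)"
  have t: "t > 0" unfolding t_def using w \<delta> n by (simp add: field_simps)
  have l: "l > 0" unfolding l_def using t w n by simp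
  have "emeasure Q {x\<in>space Q. \<not> f x < \<mu> + t}
    \<le> emeasure Q {x\<in>space Q. 1 \<le> ennreal (exp (- l * (\<mu> + t))) * ennreal (exp (l * f x))}"
  proof (rule emeasure_mono)
    have "l * (\<mu> + t) \<le> l * f x" if "\<not> f x < \<mu> + t" for x
      using that l by (intro mult_left_mono) auto
    then show "{x\<in>space Q. \<not> f x < \<mu> + t}
      \<subseteq> {x\<in>space Q. 1 \<le> ennreal (exp (- l * (\<mu> + t))) * ennreal (exp (l * f x))}"
      by (auto simp flip: ennreal_mult exp_add ennreal_1)
  qed simp
  also have "\<dots> \<le> ennreal (exp (- l * (\<mu> + t))) * (\<integral>\<^sup>+x. ennreal (exp (l * f x)) * indicator (space Q) x \<partial>Q)"
    by (rule nn_integral_Markov_inequality) auto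
  also have "(\<integral>\<^sup>+x. ennreal (exp (l * f x)) * indicator (space Q) x \<partial>Q) = (\<integral>\<^sup>+x. ennreal (exp (l * f x)) \<partial>Q)"
    by (rule nn_integral_cong) auto
  also have "ennreal (exp (- l * (\<mu> + t))) * \<dots>
      \<le> ennreal (exp (- l * (\<mu> + t))) * ennreal (exp (l * \<mu> + n * l\<^sup>2 * (w / n)\<^sup>2 / 8))"
    unfolding Q_def \<mu>_def
    using bounded_differences_exp_moment[OF _ assms(2) l, of K "w / n"] bound diff
    by (intro mult_left_mono) auto
  also have "\<dots> = ennreal (exp (- l * (\<mu> + t) + (l * \<mu> + n * l\<^sup>2 * (w / n)\<^sup>2 / 8)))"
    by (simp only: exp_add[of "- l * (\<mu> + t)"] ennreal_mult exp_ge_zero)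
  also have "- l * (\<mu> + t) + (l * \<mu> + n * l\<^sup>2 * (w / n)\<^sup>2 / 8) = - 2 * n * t\<^sup>2 / w\<^sup>2"
    unfolding l_def using w n by (simp add: field_simps power2_eq_square)
  also have "\<dots> = ln \<delta>"
  proof -
    have "t\<^sup>2 = w\<^sup>2 * (ln (1 / \<delta>) / (2 * real n))" unfolding t_def using \<delta> n by (simp add: power_mult_distrib)
    then show ?thesis using w n \<delta> by (simp add: ln_div field_simps)
  qed
  finally have "Q.prob {x\<in>space Q. \<not> f x < \<mu> + t} \<le> \<delta>"
    using \<delta> by (simp add: Q.emeasure_eq_measure)
  moreover have "Q.prob {x\<in>space Q. f x < \<mu> + t} = 1 - Q.prob {x\<in>space Q. \<not> f x < \<mu> + t}"
    by (subst Q.prob_neg) auto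
  ultimately show ?thesis by (simp add: Q_def \<mu>_def t_def)
qed

section \<open>Measurability of projections along the parameter\<close>

text \<open>By compactness and continuity in the parameter, a zero level is reached if and only if the
  function gets arbitrarily close to it on a countable dense set of parameters.\<close>
lemma sets_Ex_compact_le_zero:
  fixes g :: "'a::{metric_space, second_countable_topology} \<Rightarrow> 's \<Rightarrow> real"
  assumes K: "compact K"
    and cont: "\<And>s. s \<in> space M \<Longrightarrow> continuous_on K (\<lambda>a. g a s)"
    and meas: "\<And>a. a \<in> K \<Longrightarrow> g a \<in> borel_measurable M"
  shows "{s \<in> space M. \<exists>a\<in>K. g a s \<le> 0} \<in> sets M"
proof -
  obtain D where D: "countable D" "D \<subseteq> K" "K \<subseteq> closure D" by (rule separable)
  have "{s \<in> space M. \<exists>a\<in>K. g a s \<le> 0}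
      = {s \<in> space M. \<forall>r. \<exists>d\<in>D. g d s < 1 / Suc r}"
  proof (safe)
    fix s a r assume s: "s \<in> space M" and a: "a \<in> K" "g a s \<le> 0"
    have "g a s < 1 / Suc r" using a(2) by (rule order_le_less_trans) simp
    then have "\<forall>\<^sub>F x in at a within K. g x s < 1 / Suc r"
      using cont[OF s] a(1) by (auto simp: continuous_on_def intro: order_tendstoD)
    then obtain \<delta> where \<delta>: "\<delta> > 0" "\<And>x. x \<in> K \<Longrightarrow> x \<noteq> a \<Longrightarrow> dist x a < \<delta> \<Longrightarrow> g x s < 1 / Suc r"
      unfolding eventually_at by blast
    obtain d where d: "d \<in> D" "dist d a < \<delta>"
      using D(3) a(1) \<delta>(1) closure_approachable by blast
    then have "g d s < 1 / Suc r" using \<delta>(2)[of d] D(2) \<open>g a s < 1 / Suc r\<close> by blast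
    then show "\<exists>d\<in>D. g d s < 1 / Suc r" using d by blast
  next
    fix s assume s: "s \<in> space M" and *: "\<forall>r. \<exists>d\<in>D. g d s < 1 / Suc r"
    have "K \<noteq> {}" using * D(2) by auto
    then obtain a where a: "a \<in> K" "\<And>x. x \<in> K \<Longrightarrow> g a s \<le> g x s"
      using continuous_attains_inf[OF K _ cont[OF s]] by blast
    have "g a s \<le> 1 / Suc r" for r using * a(2) D(2) by (meson less_imp_le order_trans subsetD)
    then have "g a s \<le> 0"
      by (meson nat_approx_posE linorder_not_le)
    then show "\<exists>a\<in>K. g a s \<le> 0" using a by blast
  qed
  also have "\<dots> \<in> sets M"
  proof -
    have "{s \<in> space M. \<exists>d\<in>D. g d s < 1 / Suc r} \<in> sets M" for r
    proof (rule sets.sets_Collect_countable_Ex'[OF _ D(1)])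
      fix d assume "d \<in> D"
      then have [measurable]: "g d \<in> borel_measurable M" using D(2) meas by auto
      show "{s \<in> space M. g d s < 1 / Suc r} \<in> sets M" by measurable
    qed
    then show ?thesis by (rule sets.sets_Collect_countable_All)
  qed
  finally show ?thesis .
qed

text \<open>Projections of measurable sets need not be measurable. For \<open>F\<^sub>\<sigma>\<close> conditions they are: the
  parameter space and the sets \<open>F i\<close> are exhausted by compact and closed sets, and membership
  in finitely many closed sets is the vanishing of a sum of distances that is continuous in the
  parameter.\<close>
theorem sets_Ex_fsigma:
  fixes v :: "'a::euclidean_space \<Rightarrow> 'i \<Rightarrow> 's \<Rightarrow> 'b::{metric_space}"
  assumes V: "closed V" and I: "finite I"
    and F: "\<And>i. i \<in> I \<Longrightarrow> fsigma_in euclidean (F i)"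
    and cont: "\<And>i s. i \<in> I \<Longrightarrow> s \<in> space M \<Longrightarrow> continuous_on V (\<lambda>a. v a i s)"
    and meas: "\<And>i a. i \<in> I \<Longrightarrow> a \<in> V \<Longrightarrow> v a i \<in> borel_measurable M"
  shows "{s \<in> space M. \<exists>a\<in>V. \<forall>i\<in>I. v a i s \<in> F i} \<in> sets M"
proof -
  have "\<exists>K. (\<forall>m. closed (K m)) \<and> incseq K \<and> (\<Union>m::nat. K m) = F i" if "i \<in> I" for i
    using F[OF that] unfolding fsigma_in_ascending closed_closedin incseq_Suc_iff by simp
  then obtain K where K: "\<And>i m. i \<in> I \<Longrightarrow> closed (K i m)" "\<And>i. i \<in> I \<Longrightarrow> incseq (K i)"
    "\<And>i. i \<in> I \<Longrightarrow> (\<Union>m::nat. K i m) = F i"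
    by metis
  define g where "g m a s = (\<Sum>i\<in>I. infdist (v a i s) (K i m))" for m a s
  define W where "W N = V \<inter> cball 0 (real N)" for N
  define R where "R m N = {s \<in> space M. (\<forall>i\<in>I. K i m \<noteq> {}) \<and> (\<exists>a\<in>W N. g m a s \<le> 0)}" for m N
  have gK: "g m a s \<le> 0 \<longleftrightarrow> (\<forall>i\<in>I. v a i s \<in> K i m)" if "\<forall>i\<in>I. K i m \<noteq> {}" for m a s
  proof -
    have "g m a s \<le> 0 \<longleftrightarrow> g m a s = 0"
      unfolding g_def by (simp add: order_antisym_conv sum_nonneg infdist_nonneg)
    also have "\<dots> \<longleftrightarrow> (\<forall>i\<in>I. infdist (v a i s) (K i m) = 0)"
      unfolding g_def using I by (intro sum_nonneg_eq_0_iff) (auto simp: infdist_nonneg)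
    also have "\<dots> \<longleftrightarrow> (\<forall>i\<in>I. v a i s \<in> K i m)"
      using that K(1) by (auto simp: in_closed_iff_infdist_zero)
    finally show ?thesis .
  qed
  have "{s \<in> space M. \<exists>a\<in>V. \<forall>i\<in>I. v a i s \<in> F i} = (\<Union>m. \<Union>N. R m N)"
  proof (safe)
    fix s a assume s: "s \<in> space M" and a: "a \<in> V" "\<forall>i\<in>I. v a i s \<in> F i"
    have "\<exists>m. v a i s \<in> K i m" if "i \<in> I" for i using a(2) K(3)[OF that] that by blast
    then obtain m where m: "\<And>i. i \<in> I \<Longrightarrow> v a i s \<in> K i (m i)" by metis
    \<comment> \<open>The closed sets increase, so one level serves all of the finitely many conditions.\<close>
  define m' where "m' = Max (insert 0 (m ` I))"
    have "v a i s \<in> K i m'" if i: "i \<in> I" for i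
    proof -
      have "m i \<le> m'" unfolding m'_def using I i by (intro Max_ge) auto
      then show ?thesis using m[OF i] K(2)[OF i] by (auto dest: incseqD)
    qed
    then have *: "\<forall>i\<in>I. v a i s \<in> K i m'" by blast
    obtain N where "norm a \<le> real N" using real_arch_simple by blast
    then have "a \<in> W N" using a by (simp add: W_def)
    then have "s \<in> R m' N" using s * gK[of m' a s] by (auto simp: R_def)
    then show "s \<in> (\<Union>m. \<Union>N. R m N)" by blast
  next
    fix s m N assume "s \<in> R m N"
    then obtain a where a: "a \<in> W N" "\<forall>i\<in>I. v a i s \<in> K i m"
      using gK by (auto simp: R_def)
    then have "\<forall>i\<in>I. v a i s \<in> F i" using K(3) by blast
    then show "\<exists>a\<in>V. \<forall>i\<in>I. v a i s \<in> F i" using a(1) by (auto simp: W_def)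
  qed (auto simp: R_def)
  also have "\<dots> \<in> sets M"
  proof -
    have "R m N \<in> sets M" for m N
    proof -
    have "{s \<in> space M. \<exists>a\<in>W N. g m a s \<le> 0} \<in> sets M"
    proof (rule sets_Ex_compact_le_zero)
      show "compact (W N)" unfolding W_def using V by (intro closed_Int_compact) auto
      fix s assume "s \<in> space M"
      then show "continuous_on (W N) (\<lambda>a. g m a s)"
        unfolding g_def W_def
        by (intro continuous_on_sum continuous_on_infdist continuous_on_subset[OF cont]) auto
    next
      fix a assume "a \<in> W N"
      then have [measurable]: "v a i \<in> borel_measurable M" if "i \<in> I" for i
        using that meas by (auto simp: W_def)
      have "(\<lambda>y. infdist y (K i m)) \<in> borel_measurable borel" for i
        by (intro borel_measurable_continuous_onI continuous_on_infdist continuous_on_id)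
      then show "g m a \<in> borel_measurable M"
        unfolding g_def by (intro borel_measurable_sum) (auto intro: measurable_compose)
    qed
    then show ?thesis unfolding R_def by (cases "\<forall>i\<in>I. K i m \<noteq> {}") auto
    qed
    then show ?thesis by (auto intro!: sets.countable_UN)
  qed
  finally show ?thesis .
qed

section \<open>Uniform deviation bounds by symmetrization\<close>

text \<open>The symmetric Bernoulli case (\<open>p = 1/2\<close>) of the estimate behind Hoeffding's lemma.\<close>
lemma cosh_le_exp_half_square: "cosh (x::real) \<le> exp (x\<^sup>2 / 2)"
proof -
  have *: "cosh y \<le> exp (y\<^sup>2 / 2)" if y: "y \<ge> 0" for y :: real
  proof -
    have pos: "0 < 1 + (1/2) * (exp (2 * y) - 1)"
      by (rule less_le_trans[of _ "1/2"]) (use exp_ge_zero[of "2 * y"] in \<open>auto simp: algebra_simps\<close>)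
    have "cosh y = exp (- y) * (1 + (1/2) * (exp (2 * y) - 1))"
      by (simp add: cosh_field_def algebra_simps add_divide_distrib flip: exp_add)
    also have "\<dots> = exp (- (2 * y) * (1/2) + ln (1 + (1/2) * (exp (2 * y) - 1)))"
      using pos by (subst exp_add) (simp add: exp_ln)
    also have "\<dots> \<le> exp ((2 * y)\<^sup>2 / 8)"
      using Hoeffdings_lemma_aux[of "2 * y" "1/2"] y by simp
    finally show ?thesis by (simp add: power_mult_distrib)
  qed
  show ?thesis using *[of x] *[of "- x"] by (cases "x \<ge> 0") auto
qed

definition sign_vectors :: "nat \<Rightarrow> (nat \<Rightarrow> real) set" where
  "sign_vectors n = PiE {..<n} (\<lambda>_. {-1, 1})"

lemma finite_sign_vectors [simp]: "finite (sign_vectors n)"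
  by (simp add: sign_vectors_def finite_PiE)

lemma card_sign_vectors: "card (sign_vectors n) = 2 ^ n"
  by (simp add: sign_vectors_def card_PiE numeral_2_eq_2)

text \<open>Up to the factor \<open>2\<^sup>n\<close> the left side is the exponential moment of a Rademacher sum, which
  factors over the coordinates into hyperbolic cosines.\<close>
lemma Rademacher_exp_moment:
  fixes u :: "nat \<Rightarrow> real"
  assumes "\<And>i. i < n \<Longrightarrow> \<bar>u i\<bar> \<le> w"
  shows "(\<Sum>\<sigma>\<in>sign_vectors n. exp (l * (\<Sum>i<n. \<sigma> i * u i))) \<le> 2 ^ n * exp (n * l\<^sup>2 * w\<^sup>2 / 2)"
proof -
  have "(\<Sum>\<sigma>\<in>sign_vectors n. exp (l * (\<Sum>i<n. \<sigma> i * u i)))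
      = (\<Sum>\<sigma>\<in>sign_vectors n. \<Prod>i<n. exp (l * (\<sigma> i * u i)))"
    by (simp add: sum_distrib_left exp_sum)
  also have "\<dots> = (\<Prod>i<n. \<Sum>s\<in>{-1, 1}. exp (l * (s * u i)))"
    unfolding sign_vectors_def by (rule prod_sum_PiE[symmetric]) auto
  also have "\<dots> = (\<Prod>i<n. 2 * cosh (l * u i))"
    by (intro prod.cong) (auto simp: cosh_field_def field_simps)
  also have "\<dots> \<le> (\<Prod>i<n. 2 * exp (l\<^sup>2 * w\<^sup>2 / 2))"
  proof (rule prod_mono, safe)
    fix i assume "i < n"
    then have "(l * u i)\<^sup>2 \<le> l\<^sup>2 * w\<^sup>2"
      using power_mono[OF assms[of i], of 2] by (simp add: power_mult_distrib mult_left_mono)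
    then have "exp ((l * u i)\<^sup>2 / 2) \<le> exp (l\<^sup>2 * w\<^sup>2 / 2)" by simp
    then show "2 * cosh (l * u i) \<le> 2 * exp (l\<^sup>2 * w\<^sup>2 / 2)"
      using cosh_le_exp_half_square[of "l * u i"] by linarith
  qed (simp add: cosh_real_nonneg)
  also have "\<dots> = 2 ^ n * exp (n * l\<^sup>2 * w\<^sup>2 / 2)"
    by (simp add: power_mult_distrib flip: exp_of_nat_mult)
  finally show ?thesis .
qed

text \<open>The coordinates \<open>n, \<dots>, 2 n - 1\<close> of \<open>T\<close> are a second, independent copy (ghost sample) of the
  first \<open>n\<close> coordinates.\<close>
definition ghost_gap :: "nat \<Rightarrow> (nat \<Rightarrow> 'z) \<Rightarrow> ('z \<Rightarrow> real) \<Rightarrow> real" where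
  "ghost_gap n T h = (\<Sum>i<n. h (T (n + i)) - h (T i))"

definition sup_gap :: "nat \<Rightarrow> ('z \<Rightarrow> real) set \<Rightarrow> (nat \<Rightarrow> 'z) \<Rightarrow> real" where
  "sup_gap n H T = (SUP h\<in>H. ghost_gap n T h)"

text \<open>Exchanges \<open>i\<close> and \<open>n + i\<close> at the coordinates where \<open>\<sigma>\<close> is not \<open>1\<close>; on the ghost gap this acts
  as multiplication of the \<open>i\<close>-th summand by the sign \<open>\<sigma> i\<close>.\<close>
definition swap_index :: "nat \<Rightarrow> (nat \<Rightarrow> real) \<Rightarrow> nat \<Rightarrow> nat" where
  "swap_index n \<sigma> i =
    (if i < n then (if \<sigma> i = 1 then i else n + i) else (if \<sigma> (i - n) = 1 then i else i - n))"

lemma swap_index_involution: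
  assumes "i < 2 * n" shows "swap_index n \<sigma> (swap_index n \<sigma> i) = i"
  using assms by (auto simp: swap_index_def)

lemma swap_index_less: "i < 2 * n \<Longrightarrow> swap_index n \<sigma> i < 2 * n"
  by (auto simp: swap_index_def)

lemma ghost_gap_swap:
  assumes "\<sigma> \<in> sign_vectors n"
  shows "ghost_gap n (\<lambda>i\<in>{..<2*n}. T (swap_index n \<sigma> i)) h
    = (\<Sum>i<n. \<sigma> i * (h (T (n + i)) - h (T i)))"
  unfolding ghost_gap_def
proof (rule sum.cong[OF refl])
  fix i assume i: "i \<in> {..<n}"
  then have "\<sigma> i = -1 \<or> \<sigma> i = 1" using assms by (auto simp: sign_vectors_def)
  then show "h ((\<lambda>i\<in>{..<2*n}. T (swap_index n \<sigma> i)) (n + i)) - h ((\<lambda>i\<in>{..<2*n}. T (swap_index n \<sigma> i)) i)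
    = \<sigma> i * (h (T (n + i)) - h (T i))"
    using i by (auto simp: swap_index_def)
qed

context prob_space
begin

lemma swap_index_invariant:
  "distr (Pi\<^sub>M {..<2*n} (\<lambda>_. M)) (Pi\<^sub>M {..<2*n} (\<lambda>_. M)) (\<lambda>T. \<lambda>i\<in>{..<2*n}. T (swap_index n \<sigma> i))
    = Pi\<^sub>M {..<2*n} (\<lambda>_. M)"
proof (rule distr_PiM_reindex)
  show "inj_on (swap_index n \<sigma>) {..<2*n}"
    by (rule inj_on_inverseI[of _ "swap_index n \<sigma>"]) (simp add: swap_index_involution)
  show "swap_index n \<sigma> \<in> {..<2*n} \<rightarrow> {..<2*n}" by (auto simp: swap_index_less)
qed unfold_locales

context
  fixes H :: "('a \<Rightarrow> real) set" and w :: real and n :: nat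
  assumes H_ne: "H \<noteq> {}"
    and H_range: "\<And>h z. h \<in> H \<Longrightarrow> z \<in> space M \<Longrightarrow> 0 \<le> h z \<and> h z \<le> w"
begin

lemma coordinate_diff_le:
  assumes T: "T \<in> space (Pi\<^sub>M {..<2*n} (\<lambda>_. M))" and "h \<in> H" "i < n"
  shows "\<bar>h (T (n + i)) - h (T i)\<bar> \<le> w"
proof -
  have "T (n + i) \<in> space M" "T i \<in> space M"
    using T assms(3) by (auto simp: space_PiM PiE_def Pi_def)
  then show ?thesis using H_range[OF assms(2)] by (auto simp: abs_le_iff) (smt (verit))+
qed

lemma abs_ghost_gap_le:
  assumes "T \<in> space (Pi\<^sub>M {..<2*n} (\<lambda>_. M))" "h \<in> H"
  shows "\<bar>ghost_gap n T h\<bar> \<le> n * w"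
proof -
  have "\<bar>ghost_gap n T h\<bar> \<le> (\<Sum>i<n. \<bar>h (T (n + i)) - h (T i)\<bar>)"
    unfolding ghost_gap_def by (rule sum_abs)
  also have "\<dots> \<le> (\<Sum>i<n. w)" by (rule sum_mono) (use coordinate_diff_le[OF assms] in auto)
  finally show ?thesis by simp
qed

lemma ghost_gap_le_sup_gap:
  assumes "T \<in> space (Pi\<^sub>M {..<2*n} (\<lambda>_. M))" "h \<in> H"
  shows "ghost_gap n T h \<le> sup_gap n H T"
  unfolding sup_gap_def
proof (rule cSUP_upper[OF assms(2)])
  show "bdd_above (ghost_gap n T ` H)"
    by (rule bdd_aboveI[of _ "n * w"]) (use abs_ghost_gap_le[OF assms(1)] in \<open>auto simp: abs_le_iff\<close>)
qed

lemma sup_gap_le: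
  assumes "\<And>h. h \<in> H \<Longrightarrow> ghost_gap n T h \<le> B" shows "sup_gap n H T \<le> B"
  unfolding sup_gap_def using H_ne assms by (intro cSUP_least)

lemma abs_sup_gap_le:
  assumes T: "T \<in> space (Pi\<^sub>M {..<2*n} (\<lambda>_. M))"
  shows "\<bar>sup_gap n H T\<bar> \<le> n * w"
proof -
  obtain h where h: "h \<in> H" using H_ne by auto
  have "sup_gap n H T \<le> n * w" by (rule sup_gap_le) (use abs_ghost_gap_le[OF T] in \<open>auto simp: abs_le_iff\<close>)
  moreover have "- (n * w) \<le> sup_gap n H T"
    using abs_ghost_gap_le[OF T h] ghost_gap_le_sup_gap[OF T h] by (auto simp: abs_le_iff)
  ultimately show ?thesis by (simp add: abs_le_iff)
qed

lemma less_sup_gap_iff: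
  assumes T: "T \<in> space (Pi\<^sub>M {..<2*n} (\<lambda>_. M))"
  shows "a < sup_gap n H T \<longleftrightarrow> (\<exists>h\<in>H. a < ghost_gap n T h)"
  unfolding sup_gap_def
proof (rule less_cSUP_iff[OF H_ne])
  show "bdd_above (ghost_gap n T ` H)"
    by (rule bdd_aboveI[of _ "n * w"]) (use abs_ghost_gap_le[OF T] in \<open>auto simp: abs_le_iff\<close>)
qed

context
  fixes N :: nat
  assumes n: "n \<ge> 1"
    and H_meas: "\<And>h. h \<in> H \<Longrightarrow> h \<in> borel_measurable M"
    and sup_meas: "sup_gap n H \<in> borel_measurable (Pi\<^sub>M {..<2*n} (\<lambda>_. M))"
    and growth: "\<And>T. T \<in> space (Pi\<^sub>M {..<2*n} (\<lambda>_. M)) \<Longrightarrow>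
      finite ((\<lambda>h. \<lambda>i\<in>{..<2*n}. h (T i)) ` H) \<and> card ((\<lambda>h. \<lambda>i\<in>{..<2*n}. h (T i)) ` H) \<le> N"
begin

text \<open>On a fixed double sample the class has at most \<open>N\<close> difference vectors, and swaps only change
  the signs of their coordinates. So the supremum is a maximum of \<open>N\<close> Rademacher sums, whose
  exponential is bounded by the sum of the exponentials.\<close>
lemma sup_gap_swap_exp_sum:
  fixes l :: real
  assumes T: "T \<in> space (Pi\<^sub>M {..<2*n} (\<lambda>_. M))" and l: "l > 0"
  shows "(\<Sum>\<sigma>\<in>sign_vectors n. exp (l * sup_gap n H (\<lambda>i\<in>{..<2*n}. T (swap_index n \<sigma> i))))
    \<le> 2 ^ n * (N * exp (n * l\<^sup>2 * w\<^sup>2 / 2))"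
proof -
  define u where "u h = (\<lambda>i\<in>{..<n}. h (T (n + i)) - h (T i))" for h :: "'a \<Rightarrow> real"
  have fin: "finite (u ` H)" and card: "card (u ` H) \<le> N"
  proof -
    have *: "u h = u h'" if e: "(\<lambda>i\<in>{..<2*n}. h (T i)) = (\<lambda>i\<in>{..<2*n}. h' (T i))" for h h'
    proof -
      have "h (T i) = h' (T i)" if "i < 2 * n" for i
        using fun_cong[OF e, of i] that by simp
      then show ?thesis by (auto simp: u_def fun_eq_iff)
    qed
    show "finite (u ` H)"
      by (rule card_image_le_of_refines(1)[where g = "\<lambda>h. \<lambda>i\<in>{..<2*n}. h (T i)"])
        (use growth[OF T] in blast, erule *)
    have "card (u ` H) \<le> card ((\<lambda>h. \<lambda>i\<in>{..<2*n}. h (T i)) ` H)"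
      by (rule card_image_le_of_refines(2)) (use growth[OF T] in blast, erule *)
    then show "card (u ` H) \<le> N" using growth[OF T] by auto
  qed
  have ub: "\<bar>v i\<bar> \<le> w" if "v \<in> u ` H" "i < n" for v i
    using that coordinate_diff_le[OF T] by (auto simp: u_def)
  have bound: "exp (l * sup_gap n H (\<lambda>i\<in>{..<2*n}. T (swap_index n \<sigma> i)))
      \<le> (\<Sum>v\<in>u ` H. exp (l * (\<Sum>i<n. \<sigma> i * v i)))" if \<sigma>: "\<sigma> \<in> sign_vectors n" for \<sigma>
  proof -
    have gap: "ghost_gap n (\<lambda>i\<in>{..<2*n}. T (swap_index n \<sigma> i)) h = (\<Sum>i<n. \<sigma> i * u h i)" for h
      unfolding ghost_gap_swap[OF \<sigma>] by (simp add: u_def)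
    have "sup_gap n H (\<lambda>i\<in>{..<2*n}. T (swap_index n \<sigma> i)) = Max ((\<lambda>v. \<Sum>i<n. \<sigma> i * v i) ` u ` H)"
    proof -
      have "(\<lambda>h. \<Sum>i<n. \<sigma> i * u h i) ` H = (\<lambda>v. \<Sum>i<n. \<sigma> i * v i) ` u ` H"
        by (simp add: image_image)
      then show ?thesis
        unfolding sup_gap_def gap using fin H_ne by (simp only:) (rule cSup_eq_Max, auto)
    qed
    also have "\<dots> \<in> (\<lambda>v. \<Sum>i<n. \<sigma> i * v i) ` u ` H" by (rule Max_in) (use fin H_ne in auto)
    finally obtain v where v: "v \<in> u ` H"
      "sup_gap n H (\<lambda>i\<in>{..<2*n}. T (swap_index n \<sigma> i)) = (\<Sum>i<n. \<sigma> i * v i)" by blast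
    show ?thesis unfolding v(2) by (rule member_le_sum) (use fin v in auto)
  qed
  have "(\<Sum>\<sigma>\<in>sign_vectors n. exp (l * sup_gap n H (\<lambda>i\<in>{..<2*n}. T (swap_index n \<sigma> i))))
    \<le> (\<Sum>\<sigma>\<in>sign_vectors n. \<Sum>v\<in>u ` H. exp (l * (\<Sum>i<n. \<sigma> i * v i)))"
    by (rule sum_mono) (rule bound)
  also have "\<dots> = (\<Sum>v\<in>u ` H. \<Sum>\<sigma>\<in>sign_vectors n. exp (l * (\<Sum>i<n. \<sigma> i * v i)))"
    by (rule sum.swap)
  also have "\<dots> \<le> (\<Sum>v\<in>u ` H. 2 ^ n * exp (n * l\<^sup>2 * w\<^sup>2 / 2))"
    by (intro sum_mono Rademacher_exp_moment ub)
  also have "\<dots> \<le> real N * (2 ^ n * exp (n * l\<^sup>2 * w\<^sup>2 / 2))"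
    using card by simp
  finally show ?thesis by (simp add: mult_ac)
qed

text \<open>The law of the double sample is invariant under swaps, so the exponential moment equals its
  average over all sign vectors, which is bounded at every point.\<close>
lemma sup_gap_exp_moment:
  fixes l :: real
  assumes l: "l > 0"
  shows "(\<integral>\<^sup>+T. ennreal (exp (l * sup_gap n H T)) \<partial>Pi\<^sub>M {..<2*n} (\<lambda>_. M))
    \<le> ennreal (N * exp (n * l\<^sup>2 * w\<^sup>2 / 2))"
proof -
  define Q where "Q = Pi\<^sub>M {..<2*n} (\<lambda>_::nat. M)"
  interpret Q: prob_space Q unfolding Q_def by (rule prob_space_PiM) unfold_locales
  define sw where "sw \<sigma> T = (\<lambda>i\<in>{..<2*n}. T (swap_index n \<sigma> i))" for \<sigma> and T :: "nat \<Rightarrow> 'a"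
  have [measurable]: "sw \<sigma> \<in> measurable Q Q" for \<sigma>
    unfolding sw_def Q_def
    by (intro measurable_restrict measurable_component_singleton) (auto simp: swap_index_less)
  have [measurable]: "sup_gap n H \<in> borel_measurable Q" using sup_meas by (simp add: Q_def)
  define I where "I = (\<integral>\<^sup>+T. ennreal (exp (l * sup_gap n H T)) \<partial>Q)"
  have I: "(\<integral>\<^sup>+T. ennreal (exp (l * sup_gap n H (sw \<sigma> T))) \<partial>Q) = I" for \<sigma>
  proof -
    have "I = (\<integral>\<^sup>+T. ennreal (exp (l * sup_gap n H T)) \<partial>distr Q Q (sw \<sigma>))"
      unfolding I_def Q_def sw_def swap_index_invariant ..
    also have "\<dots> = (\<integral>\<^sup>+T. ennreal (exp (l * sup_gap n H (sw \<sigma> T))) \<partial>Q)"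
      by (rule nn_integral_distr) measurable
    finally show ?thesis ..
  qed
  have "ennreal (2 ^ n) * I = (\<Sum>\<sigma>\<in>sign_vectors n. I)"
    by (simp add: card_sign_vectors flip: ennreal_power)
  also have "\<dots> = (\<Sum>\<sigma>\<in>sign_vectors n. \<integral>\<^sup>+T. ennreal (exp (l * sup_gap n H (sw \<sigma> T))) \<partial>Q)"
    by (simp only: I)
  also have "\<dots> = (\<integral>\<^sup>+T. (\<Sum>\<sigma>\<in>sign_vectors n. ennreal (exp (l * sup_gap n H (sw \<sigma> T)))) \<partial>Q)"
    by (rule nn_integral_sum[symmetric]) measurable
  also have "\<dots> \<le> (\<integral>\<^sup>+T. ennreal (2 ^ n * (N * exp (n * l\<^sup>2 * w\<^sup>2 / 2))) \<partial>Q)"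
  proof (rule nn_integral_mono)
    fix T assume "T \<in> space Q"
    then show "(\<Sum>\<sigma>\<in>sign_vectors n. ennreal (exp (l * sup_gap n H (sw \<sigma> T))))
      \<le> ennreal (2 ^ n * (N * exp (n * l\<^sup>2 * w\<^sup>2 / 2)))"
      using sup_gap_swap_exp_sum[OF _ l, of T]
      by (simp add: sum_ennreal Q_def sw_def ennreal_leI)
  qed
  also have "\<dots> = ennreal (2 ^ n) * ennreal (N * exp (n * l\<^sup>2 * w\<^sup>2 / 2))"
    by (simp add: Q.emeasure_space_1 ennreal_mult)
  finally have "ennreal (2 ^ n) * I \<le> ennreal (2 ^ n) * ennreal (N * exp (n * l\<^sup>2 * w\<^sup>2 / 2))" .
  then have "I \<le> ennreal (N * exp (n * l\<^sup>2 * w\<^sup>2 / 2))"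
    by (subst (asm) ennreal_mult_le_mult_iff) auto
  then show ?thesis by (simp add: I_def Q_def)
qed

text \<open>The maximal inequality: Jensen's inequality turns the exponential moment into the bound
  \<open>(A + n l\<^sup>2 w\<^sup>2 / 2) / l\<close> for every \<open>l\<close>.\<close>
lemma expectation_sup_gap_le:
  assumes w: "w > 0" and A: "A > 0" "real N \<le> exp A"
  shows "(\<integral>T. sup_gap n H T \<partial>Pi\<^sub>M {..<2*n} (\<lambda>_. M)) \<le> n * w * sqrt (2 * A / n)"
proof -
  define Q where "Q = Pi\<^sub>M {..<2*n} (\<lambda>_::nat. M)"
  interpret Q: prob_space Q unfolding Q_def by (rule prob_space_PiM) unfold_locales
  have [measurable]: "sup_gap n H \<in> borel_measurable Q" using sup_meas by (simp add: Q_def)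
  \<comment> \<open>The two summands \<open>A\<close> and \<open>n l\<^sup>2 w\<^sup>2 / 2\<close> are balanced by \<open>l = r / w\<close>.\<close>
  define r where "r = sqrt (2 * A / n)"
  define l where "l = r / w"
  have r: "r > 0" "n * r\<^sup>2 = 2 * A" unfolding r_def using A n by simp_all
  have l: "l > 0" and lw: "l * w = r" unfolding l_def using w r by simp_all
  have bnd: "\<bar>sup_gap n H T\<bar> \<le> n * w" if "T \<in> space Q" for T
    using abs_sup_gap_le that by (simp add: Q_def)
  have int: "integrable Q (sup_gap n H)"
    by (rule Q.integrable_const_bound[where B = "n * w"]) (use bnd in auto)
  have inte: "integrable Q (\<lambda>T. exp (l * sup_gap n H T))"
  proof (rule Q.integrable_const_bound[where B = "exp (l * (n * w))"])
    have "sup_gap n H T \<le> n * w" if "T \<in> space Q" for T using abs_le_D1[OF bnd[OF that]] .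
    then show "AE T in Q. norm (exp (l * sup_gap n H T)) \<le> exp (l * (n * w))"
      using l by (intro AE_I2) (simp add: mult_left_mono)
  qed measurable
  define \<mu> where "\<mu> = (\<integral>T. sup_gap n H T \<partial>Q)"
  have "exp (l * \<mu>) \<le> (\<integral>T. exp (l * sup_gap n H T) \<partial>Q)"
    unfolding \<mu>_def
  proof (rule Q.jensens_inequality[OF int, of UNIV])
    show "convex_on UNIV (\<lambda>x. exp (l * x))" using l by (intro convex_on_exp) simp
  qed (use inte in simp_all)
  then have "ennreal (exp (l * \<mu>)) \<le> ennreal (\<integral>T. exp (l * sup_gap n H T) \<partial>Q)"
    by (rule ennreal_leI)
  also have "\<dots> = (\<integral>\<^sup>+T. ennreal (exp (l * sup_gap n H T)) \<partial>Q)"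
    by (rule nn_integral_eq_integral[symmetric]) (use inte in auto)
  also have "\<dots> \<le> ennreal (N * exp (n * l\<^sup>2 * w\<^sup>2 / 2))"
    unfolding Q_def by (rule sup_gap_exp_moment[OF l])
  finally have "exp (l * \<mu>) \<le> N * exp (n * l\<^sup>2 * w\<^sup>2 / 2)"
    by (subst (asm) ennreal_le_iff) auto
  also have "\<dots> \<le> exp A * exp (n * l\<^sup>2 * w\<^sup>2 / 2)" using A by (intro mult_right_mono) auto
  finally have le: "l * \<mu> \<le> A + n * l\<^sup>2 * w\<^sup>2 / 2" by (simp flip: exp_add)
  have "n * l\<^sup>2 * w\<^sup>2 / 2 = n * (l * w)\<^sup>2 / 2"
    by (simp only: power_mult_distrib mult.assoc)
  then have "l * \<mu> \<le> 2 * A" using le unfolding lw r(2) by linarith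
  also have "2 * A = l * (n * w * r)"
    unfolding r(2)[symmetric] lw[symmetric] by (simp only: power2_eq_square mult_ac)
  finally show ?thesis using l by (simp add: \<mu>_def Q_def r_def)
qed

text \<open>The random variable \<open>\<Psi>\<close> is the conditional expectation of the supremum over the double
  sample given its first half. Since the mean of the ghost gap of \<open>h\<close> given the first half is
  the scaled deviation of \<open>h\<close>, it dominates all deviations simultaneously. Its mean is controlled by
  the maximal inequality, and changing one point of the sample changes it by at most \<open>w / n\<close>.\<close>
theorem uniform_deviation_bound:
  assumes w: "w > 0" and A: "A > 0" "real N \<le> exp A" and \<delta>: "0 < \<delta>" "\<delta> < 1"
  shows "with_prob_ge (Pi\<^sub>M {..<n} (\<lambda>_. M)) (1 - \<delta>)
    (\<lambda>S. \<forall>h\<in>H. expectation h \<le> (\<Sum>i<n. h (S i)) / n + w * sqrt (2 * A / n)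
      + w * sqrt (ln (1 / \<delta>) / (2 * real n)))"
proof -
  interpret P: product_prob_space "\<lambda>_::nat. M" by unfold_locales
  define J where "J = {n..<2*n}"
  define Q where "Q = Pi\<^sub>M {..<n} (\<lambda>_::nat. M)"
  define Q' where "Q' = Pi\<^sub>M J (\<lambda>_::nat. M)"
  interpret Q: prob_space Q unfolding Q_def by (rule prob_space_PiM) unfold_locales
  interpret Q': prob_space Q' unfolding Q'_def by (rule prob_space_PiM) unfold_locales
  have disj: "{..<n} \<inter> J = {}" and union: "{..<n} \<union> J = {..<2*n}" by (auto simp: J_def)
  define mg where "mg S S' = merge {..<n} J (S, S')" for S S' :: "nat \<Rightarrow> 'a"
  define \<Psi> where "\<Psi> S = (\<integral>S'. sup_gap n H (mg S S') \<partial>Q') / n" for S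
  have mg_space: "mg S S' \<in> space (Pi\<^sub>M {..<2*n} (\<lambda>_. M))" if "S \<in> space Q" "S' \<in> space Q'" for S S'
    using that unfolding Q_def Q'_def mg_def space_PiM union[symmetric]
    by (auto simp: merge_def PiE_def Pi_def extensional_def)
  have [measurable]: "(\<lambda>(S, S'). mg S S') \<in> measurable (Q \<Otimes>\<^sub>M Q') (Pi\<^sub>M {..<2*n} (\<lambda>_. M))"
    unfolding mg_def Q_def Q'_def union[symmetric] by simp
  note [measurable] = sup_meas H_meas
  have mgS: "mg S \<in> measurable Q' (Pi\<^sub>M {..<2*n} (\<lambda>_. M))" if "S \<in> space Q" for S
    using that by measurable
  have int: "integrable Q' (\<lambda>S'. sup_gap n H (mg S S'))" if S: "S \<in> space Q" for S
    by (rule Q'.integrable_const_bound[where B = "n * w"])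
      (use abs_sup_gap_le mg_space[OF S] measurable_compose[OF mgS[OF S] sup_meas] in auto)
  have \<Psi>_meas [measurable]: "\<Psi> \<in> borel_measurable Q" unfolding \<Psi>_def by measurable
  have \<Psi>_abs: "\<bar>\<Psi> S\<bar> \<le> w" if S: "S \<in> space Q" for S
  proof -
    have "\<bar>\<integral>S'. sup_gap n H (mg S S') \<partial>Q'\<bar> \<le> (\<integral>S'. \<bar>sup_gap n H (mg S S')\<bar> \<partial>Q')"
      by (rule integral_abs_bound)
    also have "\<dots> \<le> (\<integral>S'. n * w \<partial>Q')"
      by (rule integral_mono) (use int[OF S] abs_sup_gap_le mg_space[OF S] in auto)
    finally show ?thesis using n by (simp add: \<Psi>_def Q'.prob_space field_simps)
  qed
  have le_update: "sup_gap n H (mg S S') \<le> sup_gap n H (mg (S(i := y)) S') + w"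
    if S: "S \<in> space Q" "S(i := y) \<in> space Q" and S': "S' \<in> space Q'" and i: "i < n" for S S' i y
  proof (rule sup_gap_le)
    fix h assume h: "h \<in> H"
    have z: "S i \<in> space M" "y \<in> space M"
      using S i by (auto simp: Q_def space_PiM PiE_def Pi_def)
    have "ghost_gap n (mg S S') h - ghost_gap n (mg (S(i := y)) S') h
        = (\<Sum>j<n. if j = i then h y - h (S i) else 0)"
      unfolding ghost_gap_def sum_subtractf[symmetric]
      by (rule sum.cong) (use i in \<open>auto simp: mg_def merge_def J_def\<close>)
    also have "\<dots> = h y - h (S i)" using i by simp
    also have "\<dots> \<le> w" using H_range[OF h z(1)] H_range[OF h z(2)] by linarith
    finally show "ghost_gap n (mg S S') h \<le> sup_gap n H (mg (S(i := y)) S') + w"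
      using ghost_gap_le_sup_gap[OF mg_space[OF S(2) S'] h] by linarith
  qed
  have \<Psi>_update: "\<Psi> S \<le> \<Psi> (S(i := y)) + w / n"
    if S: "S \<in> space Q" "S(i := y) \<in> space Q" and i: "i < n" for S i y
  proof -
    have "(\<integral>S'. sup_gap n H (mg S S') \<partial>Q') \<le> (\<integral>S'. sup_gap n H (mg (S(i := y)) S') + w \<partial>Q')"
      by (rule integral_mono) (use int S le_update[OF S _ i] in auto)
    also have "\<dots> = (\<integral>S'. sup_gap n H (mg (S(i := y)) S') \<partial>Q') + w"
      using int[OF S(2)] by (simp add: Q'.prob_space)
    finally show ?thesis by (simp add: \<Psi>_def divide_right_mono flip: add_divide_distrib)
  qed
  have upd_space: "S(i := y) \<in> space Q" if "S \<in> space Q" "i < n" "y \<in> space M" for S i y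
    using that by (auto simp: Q_def space_PiM PiE_def Pi_def extensional_def)
  have \<Psi>_diff: "\<bar>\<Psi> S - \<Psi> (S(i := y))\<bar> \<le> w / n"
    if S: "S \<in> space Q" and i: "i < n" and y: "y \<in> space M" for S i y
    using \<Psi>_update[OF S upd_space[OF S i y] i]
      \<Psi>_update[of "S(i := y)" i "S i"] upd_space[OF S i y] S i by (simp add: abs_le_iff)
  have E\<Psi>: "(\<integral>S. \<Psi> S \<partial>Q) \<le> w * sqrt (2 * A / n)"
  proof -
    interpret Q2: prob_space "Pi\<^sub>M {..<2*n} (\<lambda>_::nat. M)" by (rule prob_space_PiM) unfold_locales
    have "integrable (Pi\<^sub>M {..<2*n} (\<lambda>_. M)) (sup_gap n H)"
      by (rule Q2.integrable_const_bound[where B = "n * w"]) (use abs_sup_gap_le in auto)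
    then have "(\<integral>T. sup_gap n H T \<partial>Pi\<^sub>M {..<2*n} (\<lambda>_. M)) = (\<integral>S. \<integral>S'. sup_gap n H (mg S S') \<partial>Q' \<partial>Q)"
      unfolding Q_def Q'_def mg_def union[symmetric]
      by (intro P.product_integral_fold disj) (auto simp: J_def)
    then have "(\<integral>S. \<Psi> S \<partial>Q) = (\<integral>T. sup_gap n H T \<partial>Pi\<^sub>M {..<2*n} (\<lambda>_. M)) / n"
      unfolding \<Psi>_def by simp
    also have "\<dots> \<le> (n * w * sqrt (2 * A / n)) / n"
      by (intro divide_right_mono expectation_sup_gap_le[OF w A]) simp
    finally show ?thesis using n by simp
  qed
  have dominate: "expectation h - (\<Sum>i<n. h (S i)) / n \<le> \<Psi> S" if S: "S \<in> space Q" and h: "h \<in> H" for S h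
  proof -
    have hM [measurable]: "h \<in> borel_measurable M" using h by (rule H_meas)
    have comp: "(\<integral>S'. h (S' j) \<partial>Q') = expectation h \<and> integrable Q' (\<lambda>S'. h (S' j))" if j: "j \<in> J" for j
    proof
      have dist: "distr Q' M (\<lambda>S'. S' j) = M"
        unfolding Q'_def by (rule distr_PiM_component[OF _ j]) unfold_locales
      have [measurable]: "(\<lambda>S'. S' j) \<in> measurable Q' M"
        unfolding Q'_def using j by measurable
      have "expectation h = (\<integral>z. h z \<partial>distr Q' M (\<lambda>S'. S' j))" by (simp only: dist)
      also have "\<dots> = (\<integral>S'. h (S' j) \<partial>Q')" by (rule integral_distr) measurable
      finally show "(\<integral>S'. h (S' j) \<partial>Q') = expectation h" ..
      show "integrable Q' (\<lambda>S'. h (S' j))"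
      proof (rule Q'.integrable_const_bound[where B = w])
        show "AE S' in Q'. norm (h (S' j)) \<le> w"
          using H_range[OF h] j by (auto simp: Q'_def space_PiM PiE_def Pi_def intro!: AE_I2)
      qed measurable
    qed
    have gg: "ghost_gap n (mg S S') h = (\<Sum>i<n. h (S' (n + i)) - h (S i))" for S'
      unfolding ghost_gap_def by (rule sum.cong) (auto simp: mg_def merge_def J_def)
    have J: "n + i \<in> J" if "i < n" for i using that by (simp add: J_def)
    have int_h: "integrable Q' (\<lambda>S'. h (S' (n + i)))"
      and E_h: "(\<integral>S'. h (S' (n + i)) \<partial>Q') = expectation h" if "i < n" for i
      using comp[OF J[OF that]] by auto
    have int_gg: "integrable Q' (\<lambda>S'. ghost_gap n (mg S S') h)"
      unfolding gg by (intro Bochner_Integration.integrable_sum Bochner_Integration.integrable_diff int_h) auto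
    have "(\<integral>S'. ghost_gap n (mg S S') h \<partial>Q') = (\<Sum>i<n. \<integral>S'. h (S' (n + i)) - h (S i) \<partial>Q')"
      unfolding gg
      by (intro Bochner_Integration.integral_sum Bochner_Integration.integrable_diff int_h) auto
    also have "\<dots> = (\<Sum>i<n. expectation h - h (S i))"
    proof (rule sum.cong[OF refl])
      fix i assume "i \<in> {..<n}"
      then show "(\<integral>S'. h (S' (n + i)) - h (S i) \<partial>Q') = expectation h - h (S i)"
        using int_h[of i] E_h[of i] by (subst Bochner_Integration.integral_diff) (auto simp: Q'.prob_space)
    qed
    finally have "n * expectation h - (\<Sum>i<n. h (S i)) = (\<integral>S'. ghost_gap n (mg S S') h \<partial>Q')"
      by (simp add: sum_subtractf)
    also have "\<dots> \<le> (\<integral>S'. sup_gap n H (mg S S') \<partial>Q')"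
      by (rule integral_mono) (use int_gg int[OF S] ghost_gap_le_sup_gap[OF mg_space[OF S] h] in auto)
    finally have "(n * expectation h - (\<Sum>i<n. h (S i))) / n \<le> \<Psi> S"
      unfolding \<Psi>_def by (rule divide_right_mono) simp
    then show ?thesis using n by (simp add: diff_divide_distrib)
  qed
  let ?E = "{S \<in> space Q. \<Psi> S < (\<integral>S. \<Psi> S \<partial>Q) + w * sqrt (ln (1 / \<delta>) / (2 * real n))}"
  have "1 - \<delta> \<le> measure Q ?E"
    unfolding Q_def
    by (rule bounded_differences_inequality[OF n _ _ _ w \<delta>, of \<Psi> w])
      (use \<Psi>_meas \<Psi>_abs \<Psi>_diff in \<open>simp_all add: Q_def\<close>)
  moreover have "\<forall>S\<in>?E. \<forall>h\<in>H. expectation h \<le> (\<Sum>i<n. h (S i)) / n + w * sqrt (2 * A / n)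
      + w * sqrt (ln (1 / \<delta>) / (2 * real n))"
  proof (intro ballI)
    fix S h assume "S \<in> ?E" "h \<in> H"
    then have "expectation h - (\<Sum>i<n. h (S i)) / n \<le> \<Psi> S"
      "\<Psi> S < (\<integral>S. \<Psi> S \<partial>Q) + w * sqrt (ln (1 / \<delta>) / (2 * real n))"
      using dominate by blast+
    with E\<Psi> show "expectation h \<le> (\<Sum>i<n. h (S i)) / n + w * sqrt (2 * A / n)
      + w * sqrt (ln (1 / \<delta>) / (2 * real n))"
      by linarith
  qed
  moreover have "?E \<in> sets Q" by measurable
  ultimately show ?thesis unfolding with_prob_ge_def Q_def[symmetric]
    by (intro bexI[of _ ?E] conjI)
qed

end
end
end

section \<open>Linear optimisation over a polytope\<close>

lemma lin_argmin_iff: "x \<in> lin_argmin X v \<longleftrightarrow> x \<in> X \<and> (\<forall>y\<in>X. v \<bullet> x \<le> v \<bullet> y)"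
  by (auto simp: lin_argmin_def argmin_on_def is_arg_min_linorder)

text \<open>The vertices of the optimal face.\<close>
definition min_vertices :: "(real ^ 'd) set \<Rightarrow> real ^ 'd \<Rightarrow> (real ^ 'd) set" where
  "min_vertices X v = {e \<in> extreme_points X. \<forall>e'\<in>extreme_points X. v \<bullet> e \<le> v \<bullet> e'}"

lemma finite_extreme_points: "polytope X \<Longrightarrow> finite (extreme_points X)"
  using finite_polyhedron_extreme_points[OF polytope_imp_polyhedron]
  by (simp add: extreme_points_def)

lemma polytope_eq_hull_extreme_points: "polytope X \<Longrightarrow> X = convex hull (extreme_points X)"
  using Krein_Milman_Minkowski[OF polytope_imp_compact polytope_imp_convex]
  by (simp add: extreme_points_def)

lemma extreme_points_subset: "extreme_points X \<subseteq> X"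
  by (auto simp: extreme_points_def extreme_point_of_def)

text \<open>The optimal set is a face, hence a polytope whose extreme points are extreme points of \<open>X\<close>. So
  finitely many comparisons determine it.\<close>
lemma lin_argmin_eq_hull_min_vertices:
  assumes X: "polytope X" and ne: "x0 \<in> lin_argmin X v"
  shows "lin_argmin X v = convex hull (min_vertices X v)"
proof -
  have F: "lin_argmin X v = X \<inter> {x. v \<bullet> x = v \<bullet> x0}"
    using ne by (auto simp: lin_argmin_iff intro: antisym)
  have face: "lin_argmin X v face_of X" unfolding F
    by (rule face_of_Int_supporting_hyperplane_ge)
      (use X ne polytope_imp_convex in \<open>auto simp: lin_argmin_iff\<close>)
  have "lin_argmin X v = convex hull (extreme_points (lin_argmin X v))"
    by (rule polytope_eq_hull_extreme_points) (rule face_of_polytope_polytope[OF X face])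
  also have "extreme_points (lin_argmin X v) = extreme_points X \<inter> lin_argmin X v"
    using extreme_point_of_face[OF face] by (auto simp: extreme_points_def)
  also have "\<dots> = min_vertices X v"
  proof (intro equalityI subsetI)
    fix e assume e: "e \<in> min_vertices X v"
    have "X \<subseteq> {x. v \<bullet> x \<ge> v \<bullet> e}"
      by (subst polytope_eq_hull_extreme_points[OF X], rule hull_minimal)
        (use e in \<open>auto simp: min_vertices_def convex_halfspace_ge\<close>)
    then show "e \<in> extreme_points X \<inter> lin_argmin X v"
      using e extreme_points_subset by (auto simp: min_vertices_def lin_argmin_iff)
  qed (use extreme_points_subset in \<open>auto simp: min_vertices_def lin_argmin_iff\<close>)
  finally show ?thesis .
qed

locale lp_oracle_on_polytope =
  fixes X :: "(real ^ 'd) set" and xs :: "real ^ 'd \<Rightarrow> real ^ 'd"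
  assumes polytope_X: "polytope X" and xs_oracle: "lp_oracle X xs"
begin

lemma oracle_extreme: "xs v \<in> extreme_points X" and oracle_argmin: "xs v \<in> lin_argmin X v"
  using xs_oracle by (auto simp: lp_oracle_def)

lemma oracle_mem: "xs v \<in> X" and oracle_le: "y \<in> X \<Longrightarrow> v \<bullet> xs v \<le> v \<bullet> y"
  using oracle_argmin[of v] by (auto simp: lin_argmin_iff)

lemma oracle_cong_argmin: "lin_argmin X v = lin_argmin X v' \<Longrightarrow> xs v = xs v'"
  using xs_oracle unfolding lp_oracle_def by metis

lemma oracle_cong_min_vertices: "min_vertices X v = min_vertices X v' \<Longrightarrow> xs v = xs v'"
  using oracle_cong_argmin lin_argmin_eq_hull_min_vertices[OF polytope_X oracle_argmin] by metis

text \<open>The link to sign patterns: the order of the objective values at the extreme points determines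
  the decision.\<close>
lemma oracle_cong_sgn:
  assumes "\<And>e e'. e \<in> extreme_points X \<Longrightarrow> e' \<in> extreme_points X \<Longrightarrow>
    sgn (v \<bullet> (e - e')) = sgn (v' \<bullet> (e - e'))"
  shows "xs v = xs v'"
proof (rule oracle_cong_min_vertices)
  have iff: "u \<bullet> e \<le> u \<bullet> e' \<longleftrightarrow> sgn (u \<bullet> (e - e')) \<le> 0" for u e e' :: "real ^ 'd"
    by (simp add: inner_diff_right sgn_real_def)
  have "v \<bullet> e \<le> v \<bullet> e' \<longleftrightarrow> v' \<bullet> e \<le> v' \<bullet> e'"
    if "e \<in> extreme_points X" "e' \<in> extreme_points X" for e e'
    by (simp only: iff assms[OF that])
  then show "min_vertices X v = min_vertices X v'"
    unfolding min_vertices_def by (intro Collect_cong conj_cong refl ball_cong)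
qed

text \<open>Prescribing the optimal vertices gives a closed condition (they are optimal) and an open one
  (the others are not), and a fibre is a finite union of such sets.\<close>
lemma fsigma_oracle_fibre: "fsigma_in euclidean {v. xs v = e}"
proof -
  define E where "E = extreme_points X"
  have fin: "finite E" unfolding E_def by (rule finite_extreme_points[OF polytope_X])
  define R where "R T = {v. min_vertices X v = T}" for T
  have R_fsigma: "fsigma_in euclidean (R T)" if T: "T \<subseteq> E" for T
  proof -
    have "min_vertices X v = T \<longleftrightarrow>
        (\<forall>e\<in>T. \<forall>e'\<in>E. v \<bullet> e \<le> v \<bullet> e') \<and> (\<forall>e\<in>E - T. \<exists>e'\<in>E. v \<bullet> e' < v \<bullet> e)" for v
    proof -
      define P where "P e \<longleftrightarrow> (\<forall>e'\<in>E. v \<bullet> e \<le> v \<bullet> e')" for e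
      have "min_vertices X v = {e \<in> E. P e}" by (simp add: min_vertices_def E_def P_def)
      then have "min_vertices X v = T \<longleftrightarrow> (\<forall>e\<in>T. P e) \<and> (\<forall>e\<in>E - T. \<not> P e)"
        using T by blast
      then show ?thesis by (simp add: P_def not_le)
    qed
    then have "R T = (\<Inter>e\<in>T. \<Inter>e'\<in>E. {v. v \<bullet> e \<le> v \<bullet> e'}) \<inter> (\<Inter>e\<in>E - T. \<Union>e'\<in>E. {v. v \<bullet> e' < v \<bullet> e})"
      by (auto simp: R_def)
    also have "fsigma_in euclidean \<dots>"
    proof (rule fsigma_in_Int)
      have "closed (\<Inter>e\<in>T. \<Inter>e'\<in>E. {v. v \<bullet> e \<le> v \<bullet> e'})"
        by (intro closed_INT ballI closed_Collect_le continuous_intros)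
      then show "fsigma_in euclidean (\<Inter>e\<in>T. \<Inter>e'\<in>E. {v. v \<bullet> e \<le> v \<bullet> e'})"
        by (intro closed_imp_fsigma_in) simp
      have "open (\<Inter>e\<in>E - T. \<Union>e'\<in>E. {v. v \<bullet> e' < v \<bullet> e})"
        using fin by (intro open_INT open_UN ballI open_Collect_less continuous_intros) auto
      then show "fsigma_in euclidean (\<Inter>e\<in>E - T. \<Union>e'\<in>E. {v. v \<bullet> e' < v \<bullet> e})"
        by (intro open_imp_fsigma_in metrizable_space_euclidean) simp
    qed
    finally show ?thesis .
  qed
  define I where "I = {min_vertices X v |v. xs v = e}"
  have I: "I \<subseteq> Pow E" by (auto simp: I_def min_vertices_def E_def)
  have "xs v = e" if "v \<in> R T" "T \<in> I" for v T
  proof -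
    obtain v' where "xs v' = e" "min_vertices X v' = T" using \<open>T \<in> I\<close> by (auto simp: I_def)
    then show ?thesis using oracle_cong_min_vertices[of v v'] \<open>v \<in> R T\<close> by (simp add: R_def)
  qed
  then have "{v. xs v = e} = \<Union> (R ` I)" by (auto simp: R_def I_def)
  moreover have "fsigma_in euclidean (\<Union> (R ` I))"
  proof (rule fsigma_in_Union)
    show "countable (R ` I)"
      using I fin by (meson countable_finite finite_Pow_iff finite_imageI finite_subset)
  qed (use R_fsigma I in blast)
  ultimately show ?thesis by simp
qed

lemma measurable_oracle [measurable]: "xs \<in> borel_measurable borel"
proof (rule borel_measurableI)
  fix S :: "(real ^ 'd) set"
  have "{v. xs v = e} \<in> sets borel" for e
  proof -
    obtain K where K: "\<And>m::nat. closed (K m)" "(\<Union>m. K m) = {v. xs v = e}"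
      using fsigma_oracle_fibre[of e] unfolding fsigma_in_ascending closed_closedin by auto
    then show ?thesis by (metis sets.countable_UN borel_closed image_subsetI)
  qed
  then have "(\<Union>e\<in>extreme_points X \<inter> S. {v. xs v = e}) \<in> sets borel"
    using finite_extreme_points[OF polytope_X] by (intro sets.finite_UN) auto
  moreover have "xs -` S \<inter> space borel = (\<Union>e\<in>extreme_points X \<inter> S. {v. xs v = e})"
    using oracle_extreme by auto
  ultimately show "xs -` S \<inter> space borel \<in> sets borel" by simp
qed

lemma spo_loss_nonneg: "0 \<le> spo_loss xs v c"
  using oracle_le[OF oracle_mem] by (simp add: spo_loss_def)

end

text \<open>Boundedness of \<open>X\<close> and \<open>C\<close> makes the suprema and the infimum in \<^const>\<open>lp_range\<close> genuine.\<close>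
lemma inner_diff_le_lp_range:
  fixes X C :: "(real ^ 'd) set"
  assumes X: "bounded X" and C: "bounded C" and c: "c \<in> C" and xy: "x \<in> X" "y \<in> X"
  shows "c \<bullet> x - c \<bullet> y \<le> lp_range X C"
proof -
  obtain a where a: "\<And>x. x \<in> X \<Longrightarrow> norm x \<le> a" using X unfolding bounded_iff by blast
  obtain b where b: "\<And>c. c \<in> C \<Longrightarrow> norm c \<le> b" using C unfolding bounded_iff by blast
  have ip: "\<bar>c \<bullet> x\<bar> \<le> b * a" if "c \<in> C" "x \<in> X" for c x
    by (rule order_trans[OF Cauchy_Schwarz_ineq2])
      (use a[OF that(2)] b[OF that(1)] in \<open>auto intro!: mult_mono order_trans[OF norm_ge_zero]\<close>)
  have sup: "bdd_above ((\<lambda>x. c \<bullet> x) ` X)" if "c \<in> C" for c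
    by (rule bdd_aboveI[of _ "b * a"]) (use ip[OF that] in \<open>auto simp: abs_le_iff\<close>)
  have inf: "bdd_below ((\<lambda>x. c \<bullet> x) ` X)" if "c \<in> C" for c
    by (rule bdd_belowI[of _ "- (b * a)"]) (use ip[OF that] in \<open>force simp: abs_le_iff\<close>)
  have "c \<bullet> x - c \<bullet> y \<le> (SUP x\<in>X. c \<bullet> x) - (INF x\<in>X. c \<bullet> x)"
    using cSUP_upper[OF xy(1) sup[OF c]] cINF_lower[OF inf[OF c] xy(2)] by linarith
  also have "\<dots> \<le> lp_range X C"
    unfolding lp_range_def
  proof (rule cSUP_upper[OF c], rule bdd_aboveI[of _ "b * a + b * a"], safe)
    fix c assume c: "c \<in> C"
    have "(SUP x\<in>X. c \<bullet> x) \<le> b * a"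
      using xy ip[OF c] by (intro cSUP_least) (auto simp: abs_le_iff)
    moreover have "- (b * a) \<le> (INF x\<in>X. c \<bullet> x)"
      using xy ip[OF c] by (intro cINF_greatest) (force simp: abs_le_iff)+
    ultimately show "(SUP x\<in>X. c \<bullet> x) - (INF x\<in>X. c \<bullet> x) \<le> b * a + b * a" by linarith
  qed
  finally show ?thesis .
qed

text \<open>An exceptional null set can be removed from the witnessing event.\<close>
lemma with_prob_ge_AE_mono:
  assumes "with_prob_ge M r Q" and "AE S in M. Q S \<longrightarrow> Q' S"
  shows "with_prob_ge M r Q'"
proof -
  obtain E where E: "E \<in> sets M" "r \<le> measure M E" "\<forall>S\<in>E. Q S"
    using assms(1) by (auto simp: with_prob_ge_def)
  obtain N where N: "{S \<in> space M. \<not> (Q S \<longrightarrow> Q' S)} \<subseteq> N" "N \<in> null_sets M"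
    using assms(2) by (auto elim!: AE_E simp: null_sets_def)
  have "measure M (E - N) = measure M E"
    using E(1) N(2) by (simp add: measure_Diff_null_set)
  moreover have "Q' S" if "S \<in> E - N" for S
    using that E N(1) sets.sets_into_space[OF E(1)] by blast
  ultimately show ?thesis
    using E N(2) by (auto simp: with_prob_ge_def intro!: bexI[of _ "E - N"])
qed

section \<open>Generalization of linear predictors under the SPO loss\<close>

text \<open>Writes a score as a linear functional of the matrix, the form in which sign patterns count it.\<close>
lemma matrix_vector_inner_eq:
  fixes A :: "real ^ 'p ^ 'd"
  shows "(A *v \<xi>) \<bullet> w = (\<chi> r. w $ r *\<^sub>R \<xi>) \<bullet> A"
  by (simp add: inner_vec_def matrix_vector_mult_def sum_distrib_left sum_distrib_right mult_ac)

locale spo_linear_class = lp_oracle_on_polytope X xs + P: prob_space P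
  for X :: "(real ^ 'd) set" and xs and P :: "((real ^ 'p) \<times> (real ^ 'd)) measure" +
  fixes C :: "(real ^ 'd) set" and V :: "(real ^ 'p ^ 'd) set" and D :: nat and c0 :: "real ^ 'd"
  assumes sets_P: "sets P = sets borel"
    and compact_C: "compact C"
    and AE_C: "AE z in P. snd z \<in> C"
    and subspace_V: "subspace V" and dim_V: "dim V \<le> D"
begin

abbreviation "E \<equiv> extreme_points X"
abbreviation "\<omega> \<equiv> lp_range X C"

text \<open>The loss of the decision \<open>e\<close>, set to \<open>0\<close> for cost vectors outside \<open>C\<close>. Symmetrization and
  bounded differences need losses bounded at every point, while the cost lies in \<open>C\<close> only almost
  surely.\<close>
definition clipped :: "real ^ 'd \<Rightarrow> (real ^ 'p) \<times> (real ^ 'd) \<Rightarrow> real" where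
  "clipped e z = (if snd z \<in> C then snd z \<bullet> e - snd z \<bullet> xs (snd z) else 0)"

definition loss :: "real ^ 'p ^ 'd \<Rightarrow> (real ^ 'p) \<times> (real ^ 'd) \<Rightarrow> real" where
  "loss A z = clipped (xs (c0 + A *v fst z)) z"

lemma measurable_fst_P [measurable]: "fst \<in> borel_measurable P"
  and measurable_snd_P [measurable]: "snd \<in> borel_measurable P"
  by (auto simp: measurable_cong_sets[OF sets_P refl]
    intro!: borel_measurable_continuous_onI continuous_intros)

lemma borel_C: "C \<in> sets borel"
  using compact_C by (simp add: borel_closed compact_imp_closed)

lemma measurable_clipped [measurable]: "clipped e \<in> borel_measurable P"
proof -
  note [measurable] = borel_C
  show ?thesis unfolding clipped_def[abs_def] by measurable
qed

lemma measurable_score [measurable]: "(\<lambda>z. c0 + A *v fst z) \<in> borel_measurable P"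
proof (rule measurable_compose[OF measurable_fst_P])
  show "(\<lambda>\<xi>. c0 + A *v \<xi>) \<in> borel_measurable borel"
    by (intro borel_measurable_continuous_onI continuous_intros linear_continuous_on
      linear_conv_bounded_linear[THEN iffD1] matrix_vector_mul_linear)
qed

lemma measurable_spo_loss [measurable]: "(\<lambda>z. spo_loss xs (c0 + A *v fst z) (snd z)) \<in> borel_measurable P"
  unfolding spo_loss_def by measurable

lemma measurable_loss [measurable]: "loss A \<in> borel_measurable P"
proof -
  note [measurable] = borel_C
  show ?thesis unfolding loss_def[abs_def] clipped_def[abs_def] by measurable
qed

lemma loss_eq: "snd z \<in> C \<Longrightarrow> loss A z = spo_loss xs (c0 + A *v fst z) (snd z)"
  by (simp add: loss_def clipped_def spo_loss_def)

lemma loss_range: "0 \<le> loss A z \<and> loss A z \<le> max 0 \<omega>"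
proof (cases "snd z \<in> C")
  case True
  have "spo_loss xs (c0 + A *v fst z) (snd z) \<le> \<omega>"
    unfolding spo_loss_def
    by (intro inner_diff_le_lp_range oracle_mem True polytope_imp_bounded polytope_X
      compact_imp_bounded compact_C)
  then show ?thesis using spo_loss_nonneg[of "c0 + A *v fst z" "snd z"] loss_eq[OF True] by simp
qed (simp add: loss_def clipped_def)

lemma risk_eq: "spo_risk xs P (\<lambda>\<xi>. c0 + A *v \<xi>) = P.expectation (loss A)"
  unfolding spo_risk_def
  by (rule integral_cong_AE) (use AE_C loss_eq in auto)

lemma AE_sample_in_C:
  fixes n :: nat
  shows "AE S in Pi\<^sub>M {..<n} (\<lambda>_. P). \<forall>i<n. snd (S i) \<in> C"
proof -
  have "AE S in Pi\<^sub>M {..<n} (\<lambda>_. P). \<forall>i\<in>{..<n}. snd (S i) \<in> C"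
    by (intro AE_finite_allI AE_PiM_component[where P = "\<lambda>z. snd z \<in> C"] AE_C)
      (auto intro: P.prob_space_axioms)
  then show ?thesis by (simp only: Ball_def lessThan_iff)
qed

lemma emp_risk_eq:
  "\<forall>i<n. snd (S i) \<in> C \<Longrightarrow> emp_spo_risk xs n S (\<lambda>\<xi>. c0 + A *v \<xi>) = (\<Sum>i<n. loss A (S i)) / n"
  by (simp add: emp_spo_risk_def loss_eq)

text \<open>For a fixed sample, the score differences \<open>(c\<^sub>0 + A \<xi>\<^sub>i) \<bullet> (e - e')\<close> are
  \<open>m |E|\<^sup>2\<close> affine functions of \<open>A\<close> whose signs determine all decisions.\<close>
lemma card_loss_patterns:
  "finite ((\<lambda>h. \<lambda>i\<in>{..<m}. h (T i)) ` loss ` V)"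
  "card ((\<lambda>h. \<lambda>i\<in>{..<m}. h (T i)) ` loss ` V) \<le> (2 * (m * (card E)\<^sup>2) + 1) ^ D"
proof -
  define J where "J = {..<m} \<times> E \<times> E"
  define b :: "nat \<times> (real ^ 'd) \<times> (real ^ 'd) \<Rightarrow> real ^ 'p ^ 'd"
    where "b = (\<lambda>(i, e, e'). \<chi> r. (e - e') $ r *\<^sub>R fst (T i))"
  define a :: "nat \<times> (real ^ 'd) \<times> (real ^ 'd) \<Rightarrow> real" where "a = (\<lambda>(i, e, e'). - (c0 \<bullet> (e - e')))"
  have finJ: "finite J" unfolding J_def by (simp add: finite_extreme_points[OF polytope_X])
  have score: "(c0 + A *v fst (T i)) \<bullet> (e - e') = b (i, e, e') \<bullet> A - a (i, e, e')" for A i e e'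
    by (simp add: a_def b_def inner_add_left matrix_vector_inner_eq)
  have cong: "(\<lambda>i\<in>{..<m}. loss A (T i)) = (\<lambda>i\<in>{..<m}. loss A' (T i))"
    if eq: "sign_pattern b a J A = sign_pattern b a J A'" for A A'
  proof (rule restrict_ext)
    fix i assume i: "i \<in> {..<m}"
    have "xs (c0 + A *v fst (T i)) = xs (c0 + A' *v fst (T i))"
    proof (rule oracle_cong_sgn)
      fix e e' assume "e \<in> E" "e' \<in> E"
      then have "(i, e, e') \<in> J" using i by (simp add: J_def)
      then show "sgn ((c0 + A *v fst (T i)) \<bullet> (e - e')) = sgn ((c0 + A' *v fst (T i)) \<bullet> (e - e'))"
        using fun_cong[OF eq, of "(i, e, e')"] by (simp add: score sign_pattern_def)
    qed
    then show "loss A (T i) = loss A' (T i)" by (simp add: loss_def)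
  qed
  have fin: "finite (sign_pattern b a J ` V)" by (rule finite_sign_patterns[OF finJ])
  show "finite ((\<lambda>h. \<lambda>i\<in>{..<m}. h (T i)) ` loss ` V)"
    unfolding image_image by (rule card_image_le_of_refines(1)[OF fin]) (erule cong)
  have "card ((\<lambda>h. \<lambda>i\<in>{..<m}. h (T i)) ` loss ` V) \<le> card (sign_pattern b a J ` V)"
    unfolding image_image by (rule card_image_le_of_refines(2)[OF fin]) (erule cong)
  also have "\<dots> \<le> (2 * card J + 1) ^ D"
    by (rule card_sign_patterns[OF finJ])
      (use subspace_V dim_V in \<open>auto simp: subspace_imp_affine aff_dim_subspace\<close>)
  also have "card J = m * (card E)\<^sup>2" by (simp add: J_def card_cartesian_product power2_eq_square)
  finally show "card ((\<lambda>h. \<lambda>i\<in>{..<m}. h (T i)) ` loss ` V) \<le> (2 * (m * (card E)\<^sup>2) + 1) ^ D" .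
qed

text \<open>The supremum exceeds \<open>a\<close> if and only if some pattern \<open>\<pi>\<close> of decisions has a ghost gap above
  \<open>a\<close> and is realized by some parameter. There are finitely many patterns, the first condition is
  measurable for a fixed pattern, and the second one is a projection of an \<open>F\<^sub>\<sigma>\<close> set.\<close>
lemma measurable_sup_gap:
  "sup_gap n (loss ` V) \<in> borel_measurable (Pi\<^sub>M {..<2*n} (\<lambda>_. P))"
proof (rule borel_measurableI_greater)
  fix a
  define Q where "Q = Pi\<^sub>M {..<2*n} (\<lambda>_::nat. P)"
  define gap where "gap \<pi> T = (\<Sum>i<n. clipped (\<pi> (n + i)) (T (n + i)) - clipped (\<pi> i) (T i))"
    for \<pi> and T :: "nat \<Rightarrow> (real ^ 'p) \<times> (real ^ 'd)"
  define score where "score A i T = c0 + A *v fst (T i)"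
    for A :: "real ^ 'p ^ 'd" and i and T :: "nat \<Rightarrow> (real ^ 'p) \<times> (real ^ 'd)"
  define Pats where "Pats = PiE {..<2*n} (\<lambda>_. E)"
  define R where "R \<pi> = {T \<in> space Q. a < gap \<pi> T}
    \<inter> {T \<in> space Q. \<exists>A\<in>V. \<forall>i\<in>{..<2*n}. score A i T \<in> {v. xs v = \<pi> i}}" for \<pi>
  have comp: "(\<lambda>T. T i) \<in> measurable Q P" if "i < 2 * n" for i
    unfolding Q_def using that by (intro measurable_component_singleton) auto
  have ne: "loss ` V \<noteq> {}" using subspace_0[OF subspace_V] by auto
  have "{T \<in> space Q. a < sup_gap n (loss ` V) T} = (\<Union>\<pi>\<in>Pats. R \<pi>)"
  proof -
    have "a < sup_gap n (loss ` V) T \<longleftrightarrow> (\<exists>\<pi>\<in>Pats. T \<in> R \<pi>)" if T: "T \<in> space Q" for T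
    proof -
      have "a < sup_gap n (loss ` V) T \<longleftrightarrow> (\<exists>A\<in>V. a < ghost_gap n T (loss A))"
        using P.less_sup_gap_iff[OF ne _ T[unfolded Q_def], of "max 0 \<omega>" a] loss_range by auto
      also have "\<dots> \<longleftrightarrow> (\<exists>\<pi>\<in>Pats. T \<in> R \<pi>)"
      proof safe
        fix A assume A: "A \<in> V" "a < ghost_gap n T (loss A)"
        define \<pi> where "\<pi> = (\<lambda>i\<in>{..<2*n}. xs (score A i T))"
        have "gap \<pi> T = ghost_gap n T (loss A)"
          unfolding gap_def ghost_gap_def by (intro sum.cong) (auto simp: \<pi>_def loss_def score_def)
        then have "T \<in> R \<pi>" using A T by (auto simp: R_def \<pi>_def)
        moreover have "\<pi> \<in> Pats" by (simp add: Pats_def \<pi>_def oracle_extreme)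
        ultimately show "\<exists>\<pi>\<in>Pats. T \<in> R \<pi>" by blast
      next
        fix \<pi> assume "T \<in> R \<pi>"
        then obtain A where A: "A \<in> V" "\<And>i. i < 2 * n \<Longrightarrow> xs (score A i T) = \<pi> i" and gt: "a < gap \<pi> T"
          by (auto simp: R_def)
        have "gap \<pi> T = ghost_gap n T (loss A)"
          unfolding gap_def ghost_gap_def
          by (intro sum.cong) (auto simp: loss_def simp flip: score_def A(2))
        then show "\<exists>A\<in>V. a < ghost_gap n T (loss A)" using A gt by auto
      qed
      finally show ?thesis .
    qed
    then show ?thesis by (auto simp: R_def)
  qed
  also have "\<dots> \<in> sets Q"
  proof (rule sets.finite_UN)
    show "finite Pats" unfolding Pats_def by (intro finite_PiE) (auto simp: finite_extreme_points[OF polytope_X])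
    fix \<pi>
    have [measurable]: "gap \<pi> \<in> borel_measurable Q"
      unfolding gap_def
      by (intro borel_measurable_sum borel_measurable_diff measurable_compose[OF comp measurable_clipped]) auto
    have "{T \<in> space Q. \<exists>A\<in>V. \<forall>i\<in>{..<2*n}. score A i T \<in> {v. xs v = \<pi> i}} \<in> sets Q"
    proof (rule sets_Ex_fsigma)
      show "closed V" by (rule closed_subspace[OF subspace_V])
      show "continuous_on V (\<lambda>A. score A i T)" for i T
        unfolding score_def
        by (intro continuous_intros linear_continuous_on linear_conv_bounded_linear[THEN iffD1])
          (auto intro!: linearI simp: matrix_vector_mult_add_rdistrib scaleR_matrix_vector_assoc)
      show "score A i \<in> borel_measurable Q" if "i \<in> {..<2*n}" for A i
        unfolding score_def using that by (intro measurable_compose[OF comp measurable_score]) auto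
    qed (auto intro: fsigma_oracle_fibre)
    moreover have "{T \<in> space Q. a < gap \<pi> T} \<in> sets Q" by measurable
    ultimately show "R \<pi> \<in> sets Q" unfolding R_def by (intro sets.Int)
  qed
  finally show "{T \<in> space (Pi\<^sub>M {..<2*n} (\<lambda>_. P)). a < sup_gap n (loss ` V) T} \<in> sets (Pi\<^sub>M {..<2*n} (\<lambda>_. P))"
    by (simp add: Q_def)
qed

text \<open>With \<open>x = n m\<^sup>2 \<ge> 4\<close> the count \<open>(4 x + 1)\<^sup>D\<close> for \<open>2 n\<close> points is at most \<open>x\<^sup>4\<^sup>D\<close>. The exponent
  \<open>4 (D + 1) ln x\<close> turns the bound \<open>\<omega> sqrt (2 A / n)\<close> into
  \<open>2 \<omega> sqrt (2 (D + 1) ln x / n)\<close>.\<close>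
lemma growth_le_exp:
  assumes "n \<ge> 1" "m \<ge> (2::nat)"
  shows "real ((2 * (2 * n * m\<^sup>2) + 1) ^ D) \<le> exp (4 * real (D + 1) * ln (real n * (real m)\<^sup>2))"
proof -
  define x where "x = real n * (real m)\<^sup>2"
  have "1 * 2\<^sup>2 \<le> x" unfolding x_def using assms by (intro mult_mono power_mono) auto
  then have x: "x \<ge> 4" by simp
  have "4 * x + 1 \<le> x * x * x * x"
  proof -
    have "4 * x \<le> x * x" using x by (intro mult_right_mono) auto
    moreover have "4 * 4 \<le> x * x" using x by (intro mult_mono) auto
    moreover have "(x * x) * (4 * 4) \<le> (x * x) * (x * x)" using x by (intro mult_mono) auto
    ultimately show ?thesis by (simp add: mult.assoc)
  qed
  then have 1: "4 * x + 1 \<le> x ^ 4" by (simp add: eval_nat_numeral mult.assoc)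
  have "real ((2 * (2 * n * m\<^sup>2) + 1) ^ D) = (4 * x + 1) ^ D" by (simp add: x_def mult.assoc add.commute)
  also have "\<dots> \<le> (x ^ 4) ^ D" using 1 x by (intro power_mono) auto
  also have "\<dots> \<le> x ^ (4 * (D + 1))" using x by (simp add: power_mult[symmetric] power_increasing)
  also have "\<dots> = exp (real (4 * (D + 1)) * ln x)"
    using x by (simp only: exp_of_nat_mult) simp
  finally show ?thesis by (simp add: x_def)
qed

text \<open>Apart from the degenerate case of a single vertex or of a vanishing range, in which all losses
  are \<open>0\<close> almost surely, this is the uniform deviation bound for the clipped losses.\<close>
theorem spo_generalization_bound:
  assumes n: "n \<ge> 1" and \<delta>: "0 < \<delta>" "\<delta> < 1"
  shows "with_prob_ge (Pi\<^sub>M {..<n} (\<lambda>_. P)) (1 - \<delta>)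
    (\<lambda>S. \<forall>A\<in>V. spo_risk xs P (\<lambda>\<xi>. c0 + A *v \<xi>) \<le> emp_spo_risk xs n S (\<lambda>\<xi>. c0 + A *v \<xi>)
      + 2 * \<omega> * sqrt (2 * real (D + 1) * ln (real n * (real (card E))\<^sup>2) / real n)
      + \<omega> * sqrt (ln (1 / \<delta>) / (2 * real n)))"
proof -
  define Q where "Q = Pi\<^sub>M {..<n} (\<lambda>_::nat. P)"
  interpret Q: prob_space Q unfolding Q_def by (rule prob_space_PiM) unfold_locales
  define L where "L = ln (real n * (real (card E))\<^sup>2)"
  have card_pos: "card E \<ge> 1"
    using finite_extreme_points[OF polytope_X] oracle_extreme[of 0]
    by (metis One_nat_def Suc_leI card_gt_0_iff empty_iff)
  have \<omega>: "\<omega> \<ge> 0"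
  proof -
    have "C \<noteq> {}" using AE_C by auto
    then obtain c where c: "c \<in> C" by blast
    have "c \<bullet> xs 0 - c \<bullet> xs 0 \<le> \<omega>"
      by (intro inner_diff_le_lp_range oracle_mem c polytope_imp_bounded polytope_X
        compact_imp_bounded compact_C)
    then show ?thesis by simp
  qed
  have "1 * 1\<^sup>2 \<le> real n * (real (card E))\<^sup>2" using n card_pos by (intro mult_mono power_mono) auto
  then have L: "L \<ge> 0" by (simp add: L_def)
  show ?thesis
  proof (cases "card E \<ge> 2 \<and> \<omega> > 0")
    case True
    have "with_prob_ge Q (1 - \<delta>) (\<lambda>S. \<forall>h\<in>loss ` V. P.expectation h \<le> (\<Sum>i<n. h (S i)) / n
        + \<omega> * sqrt (2 * (4 * real (D + 1) * L) / n) + \<omega> * sqrt (ln (1 / \<delta>) / (2 * real n)))"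
      unfolding Q_def
    proof (rule P.uniform_deviation_bound[where N = "(2 * (2 * n * (card E)\<^sup>2) + 1) ^ D"])
      show "loss ` V \<noteq> {}" using subspace_0[OF subspace_V] by auto
      show "0 \<le> h z \<and> h z \<le> \<omega>" if "h \<in> loss ` V" for h z
        using that loss_range[of _ z] \<omega> by auto
      have "1 * 2\<^sup>2 \<le> real n * (real (card E))\<^sup>2" using n True by (intro mult_mono power_mono) auto
      then show "0 < 4 * real (D + 1) * L" by (simp add: L_def)
      show "real ((2 * (2 * n * (card E)\<^sup>2) + 1) ^ D) \<le> exp (4 * real (D + 1) * L)"
        unfolding L_def using growth_le_exp n True by blast
      show "finite ((\<lambda>h. \<lambda>i\<in>{..<2*n}. h (T i)) ` loss ` V) \<and>
        card ((\<lambda>h. \<lambda>i\<in>{..<2*n}. h (T i)) ` loss ` V) \<le> (2 * (2 * n * (card E)\<^sup>2) + 1) ^ D" for T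
        using card_loss_patterns by blast
    qed (use n True \<delta> measurable_sup_gap in auto)
    then show ?thesis
      unfolding Q_def[symmetric] L_def[symmetric]
    proof (rule with_prob_ge_AE_mono)
      have "sqrt (2 * (4 * real (D + 1) * L) / n) = 2 * sqrt (2 * real (D + 1) * L / n)"
        using real_sqrt_mult[of 4 "2 * real (D + 1) * L / n"] by (simp add: mult_ac)
      then have sqrt_eq: "\<omega> * sqrt (2 * (4 * real (D + 1) * L) / n) = 2 * \<omega> * sqrt (2 * real (D + 1) * L / n)"
        by simp
      show "AE S in Q. (\<forall>h\<in>loss ` V. P.expectation h \<le> (\<Sum>i<n. h (S i)) / n
          + \<omega> * sqrt (2 * (4 * real (D + 1) * L) / n) + \<omega> * sqrt (ln (1 / \<delta>) / (2 * real n)))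
        \<longrightarrow> (\<forall>A\<in>V. spo_risk xs P (\<lambda>\<xi>. c0 + A *v \<xi>) \<le> emp_spo_risk xs n S (\<lambda>\<xi>. c0 + A *v \<xi>)
          + 2 * \<omega> * sqrt (2 * real (D + 1) * L / n) + \<omega> * sqrt (ln (1 / \<delta>) / (2 * real n)))"
        using AE_sample_in_C[of n] unfolding Q_def[symmetric] sqrt_eq
      proof eventually_elim
        case (elim S)
        show ?case unfolding risk_eq emp_risk_eq[OF elim] by blast
      qed
    qed
  next
    case False
    have "loss A z = 0" for A z
    proof (cases "\<omega> > 0")
      case True
      then have "card E = 1" using False card_pos by auto
      then obtain e where "E = {e}" by (rule card_1_singletonE)
      then have "xs v = e" for v using oracle_extreme[of v] by simp
      then show ?thesis by (simp add: loss_def clipped_def)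
    qed (use loss_range[of A z] \<omega> in auto)
    then have zero: "loss A = (\<lambda>z. 0)" for A by (simp add: fun_eq_iff)
    have "with_prob_ge Q (1 - \<delta>) (\<lambda>S. True)"
      unfolding with_prob_ge_def using Q.prob_space \<delta> by (intro bexI[of _ "space Q"]) auto
    then show ?thesis unfolding Q_def[symmetric] L_def[symmetric]
    proof (rule with_prob_ge_AE_mono)
      have nonneg: "0 \<le> 2 * \<omega> * sqrt (2 * real (D + 1) * L / n) + \<omega> * sqrt (ln (1 / \<delta>) / (2 * real n))"
        using \<omega> L \<delta> by (intro add_nonneg_nonneg mult_nonneg_nonneg) auto
      show "AE S in Q. True \<longrightarrow> (\<forall>A\<in>V. spo_risk xs P (\<lambda>\<xi>. c0 + A *v \<xi>) \<le> emp_spo_risk xs n S (\<lambda>\<xi>. c0 + A *v \<xi>)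
          + 2 * \<omega> * sqrt (2 * real (D + 1) * L / n) + \<omega> * sqrt (ln (1 / \<delta>) / (2 * real n)))"
        using AE_sample_in_C[of n] unfolding Q_def[symmetric]
      proof eventually_elim
        case (elim S)
        have "spo_risk xs P (\<lambda>\<xi>. c0 + A *v \<xi>) = 0"
          and "emp_spo_risk xs n S (\<lambda>\<xi>. c0 + A *v \<xi>) = 0" for A
          by (simp_all add: risk_eq emp_risk_eq[OF elim] zero)
        then show ?case using nonneg by (simp only: add_0) blast
      qed
    qed
  qed
qed

end

section \<open>The Mahalanobis projection\<close>

context
  fixes Sig :: "real ^ 'd ^ 'd"
  assumes Sig: "pos_def Sig"
begin

lemma pos_def_symmetric: "x \<bullet> (Sig *v y) = (Sig *v x) \<bullet> y"
proof -
  have "x \<bullet> (Sig *v y) = (x v* Sig) \<bullet> y" by (simp add: dot_lmul_matrix)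
  also have "x v* Sig = Sig *v x"
    using Sig vector_transpose_matrix[of x Sig] by (simp add: pos_def_def)
  finally show ?thesis .
qed

lemma pos_def_quadratic_pos: "x \<noteq> 0 \<Longrightarrow> 0 < x \<bullet> (Sig *v x)"
  using Sig by (simp add: pos_def_def)

lemma pos_def_quadratic_nonneg: "0 \<le> x \<bullet> (Sig *v x)"
  using pos_def_quadratic_pos[of x] by (cases "x = 0") auto

lemma pos_def_quadratic_eq_0: "x \<bullet> (Sig *v x) = 0 \<Longrightarrow> x = 0"
  using pos_def_quadratic_pos[of x] by (cases "x = 0") auto

lemma pos_def_matrix_inv:
  "Sig *v (matrix_inv Sig *v u) = u" "matrix_inv Sig *v (Sig *v u) = u"
proof -
  have "inj ((*v) Sig)"
  proof (rule injI)
    fix x y assume "Sig *v x = Sig *v y"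
    then have "(x - y) \<bullet> (Sig *v (x - y)) = 0" by (simp add: matrix_vector_mult_diff_distrib)
    then show "x = y" using pos_def_quadratic_eq_0 by force
  qed
  then have inv: "invertible Sig"
    by (metis invertible_left_inverse matrix_left_invertible_injective)
  have matrix_inv: "Sig ** matrix_inv Sig = mat 1 \<and> matrix_inv Sig ** Sig = mat 1"
    unfolding matrix_inv_def by (rule someI_ex) (use inv in \<open>simp add: invertible_def\<close>)
  show "Sig *v (matrix_inv Sig *v u) = u" "matrix_inv Sig *v (Sig *v u) = u"
    by (simp_all add: matrix_vector_mul_assoc matrix_inv)
qed

text \<open>The constant is the minimum of the quadratic form on the unit sphere.\<close>
lemma pos_def_coercive:
  obtains \<mu> where "\<mu> > 0" "\<And>x. \<mu> * (norm x)\<^sup>2 \<le> x \<bullet> (Sig *v x)"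
proof -
  have lin: "continuous_on A (\<lambda>x. Sig *v x)" for A
    by (intro linear_continuous_on linear_conv_bounded_linear[THEN iffD1] matrix_vector_mul_linear)
  have cont: "continuous_on (sphere 0 1) (\<lambda>x. x \<bullet> (Sig *v x))"
    by (intro continuous_intros lin)
  have "axis i 1 \<in> sphere (0 :: real ^ 'd) 1" for i by simp
  then have "sphere (0 :: real ^ 'd) 1 \<noteq> {}" by blast
  from continuous_attains_inf[OF compact_sphere this cont]
  obtain x0 :: "real ^ 'd" where x0: "x0 \<in> sphere 0 1"
    "\<And>x. x \<in> sphere 0 1 \<Longrightarrow> x0 \<bullet> (Sig *v x0) \<le> x \<bullet> (Sig *v x)"
    by blast
  show ?thesis
  proof
    show "x0 \<bullet> (Sig *v x0) > 0" using x0(1) by (intro pos_def_quadratic_pos) auto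
    fix x
    show "x0 \<bullet> (Sig *v x0) * (norm x)\<^sup>2 \<le> x \<bullet> (Sig *v x)"
    proof (cases "x = 0")
      case False
      have "x0 \<bullet> (Sig *v x0) \<le> (x /\<^sub>R norm x) \<bullet> (Sig *v (x /\<^sub>R norm x))"
        using False by (intro x0(2)) simp
      also have "\<dots> = (x \<bullet> (Sig *v x)) / (norm x)\<^sup>2"
        by (simp add: matrix_vector_mult_scaleR divide_inverse power2_eq_square mult_ac)
      finally show ?thesis using False by (simp add: pos_le_divide_eq)
    qed simp
  qed
qed

text \<open>The ellipsoid is the image of \<open>{w. w \<bullet> \<Sigma> w \<le> 1}\<close> under \<open>w \<mapsto> c\<^sub>0 + \<Sigma> w\<close>.\<close>
lemma compact_ellipsoid: "compact (ellipsoid c0 Sig)"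
proof -
  obtain \<mu> where \<mu>: "\<mu> > 0" "\<And>x. \<mu> * (norm x)\<^sup>2 \<le> x \<bullet> (Sig *v x)" using pos_def_coercive by blast
  have lin: "continuous_on A (\<lambda>x. Sig *v x)" for A
    by (intro linear_continuous_on linear_conv_bounded_linear[THEN iffD1] matrix_vector_mul_linear)
  define K where "K = {w. w \<bullet> (Sig *v w) \<le> 1}"
  have "closed K" unfolding K_def by (intro closed_Collect_le continuous_intros lin)
  moreover have "bounded K"
  proof (rule boundedI)
    fix w assume "w \<in> K"
    then have "\<mu> * (norm w)\<^sup>2 \<le> 1" using \<mu>(2)[of w] by (simp add: K_def)
    then have "(norm w)\<^sup>2 \<le> 1 / \<mu>" using \<mu>(1) by (simp add: field_simps)
    then show "norm w \<le> sqrt (1 / \<mu>)" by (rule real_le_rsqrt)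
  qed
  ultimately have "compact ((\<lambda>w. c0 + Sig *v w) ` K)"
    by (intro compact_continuous_image continuous_intros lin) (simp add: compact_eq_bounded_closed)
  also have "(\<lambda>w. c0 + Sig *v w) ` K = ellipsoid c0 Sig"
  proof (intro equalityI subsetI)
    fix c assume "c \<in> ellipsoid c0 Sig"
    then have "matrix_inv Sig *v (c - c0) \<in> K"
      by (simp add: K_def ellipsoid_def pos_def_matrix_inv inner_commute)
    moreover have "c = c0 + Sig *v (matrix_inv Sig *v (c - c0))" by (simp add: pos_def_matrix_inv)
    ultimately show "c \<in> (\<lambda>w. c0 + Sig *v w) ` K" by blast
  qed (auto simp: K_def ellipsoid_def pos_def_matrix_inv inner_commute)
  finally show ?thesis .
qed

context
  fixes k :: nat and U :: "nat \<Rightarrow> real ^ 'd" and W :: "(real ^ 'd) set"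
  assumes U: "orthonormal_basis k U W"
begin

abbreviation "gram \<equiv> (\<lambda>a b. U a \<bullet> (Sig *v U b))"

lemma basis_inner: "i < k \<Longrightarrow> j < k \<Longrightarrow> U i \<bullet> U j = (if i = j then 1 else 0)"
  using U by (simp add: orthonormal_basis_def)

lemma basis_span: "span (U ` {..<k}) = W" using U by (simp add: orthonormal_basis_def)

lemma basis_mem: "i < k \<Longrightarrow> U i \<in> W" unfolding basis_span[symmetric] by (rule span_base) auto

lemma basis_combination_inner:
  assumes "i < k" shows "U i \<bullet> (\<Sum>j<k. a j *\<^sub>R U j) = a i"
proof -
  have "U i \<bullet> (\<Sum>j<k. a j *\<^sub>R U j) = (\<Sum>j<k. if j = i then a j else 0)"
    unfolding inner_sum_right by (rule sum.cong) (use assms basis_inner[of i] in auto)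
  then show ?thesis using assms by simp
qed

lemma basis_expansion: "w \<in> W \<Longrightarrow> (\<Sum>j<k. (U j \<bullet> w) *\<^sub>R U j) = w"
proof -
  assume "w \<in> W"
  then obtain a where w: "w = (\<Sum>x\<in>U ` {..<k}. a x *\<^sub>R x)"
    unfolding basis_span[symmetric] span_finite[OF finite_imageI[OF finite_lessThan]] by auto
  have "inj_on U {..<k}"
  proof (rule inj_onI)
    fix i j assume "i \<in> {..<k}" "j \<in> {..<k}" "U i = U j"
    then show "i = j" using basis_inner[of i j] basis_inner[of i i] by (cases "i = j") auto
  qed
  then have w': "w = (\<Sum>j<k. a (U j) *\<^sub>R U j)" unfolding w by (simp add: sum.reindex)
  show ?thesis unfolding w' by (intro sum.cong refl) (simp add: basis_combination_inner)
qed

lemma inner_eq_on_span: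
  assumes "\<And>i. i < k \<Longrightarrow> U i \<bullet> u = U i \<bullet> v" and "w \<in> W"
  shows "w \<bullet> u = w \<bullet> v"
proof -
  have "(\<Sum>j<k. (U j \<bullet> w) *\<^sub>R U j) \<bullet> u = (\<Sum>j<k. (U j \<bullet> w) *\<^sub>R U j) \<bullet> v"
    unfolding inner_sum_left by (rule sum.cong) (use assms(1) in auto)
  then show ?thesis by (simp add: basis_expansion[OF assms(2)])
qed

text \<open>The compression of \<open>\<Sigma>\<close> to \<open>W\<close>, extended by the identity on the orthogonal complement, is
  injective because \<open>\<Sigma>\<close> is positive definite. The matrix of its inverse in the basis \<open>U\<close> inverts the
  Gram matrix \<open>U\<^sup>T \<Sigma> U\<close>.\<close>
lemma gram_inverse_exists:
  "\<exists>H. \<forall>i<k. \<forall>j<k. (\<Sum>l<k. gram i l * H l j) = (if i = j then 1 else 0) \<and>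
     (\<Sum>l<k. H i l * gram l j) = (if i = j then 1 else 0)"
proof -
  define pr where "pr x = (\<Sum>j<k. (U j \<bullet> x) *\<^sub>R U j)" for x
  \<comment> \<open>\<open>pr\<close> is the orthogonal projection onto \<open>W\<close>. With the summand \<open>x - pr x\<close> the map \<open>T\<close> is
    defined on the whole space, where injectivity gives an inverse.\<close>
  define T where "T x = pr (Sig *v pr x) + (x - pr x)" for x
  have pr_lin: "linear pr"
    unfolding pr_def
    by (rule linearI) (simp_all add: inner_add_right scaleR_add_left sum.distrib scaleR_sum_right)
  have pr_W: "pr x \<in> W" for x
    unfolding pr_def basis_span[symmetric] by (intro span_sum span_scale span_base) auto
  have pr_id: "pr w = w" if "w \<in> W" for w using basis_expansion[OF that] by (simp add: pr_def)
  have U_pr: "U i \<bullet> pr x = U i \<bullet> x" if "i < k" for i x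
    unfolding pr_def using that by (rule basis_combination_inner)
  have pr_inner: "w \<bullet> pr x = w \<bullet> x" if "w \<in> W" for w x
    using U_pr that by (rule inner_eq_on_span)
  have T_lin: "linear T"
    unfolding T_def
    by (intro linear_compose_add linear_compose_sub linear_id[unfolded id_def] pr_lin
      linear_compose[OF linear_compose[OF pr_lin matrix_vector_mul_linear] pr_lin, unfolded o_def])
  have pr_T: "pr (T x) = pr (Sig *v pr x)" for x
    unfolding T_def by (simp add: linear_add[OF pr_lin] linear_diff[OF pr_lin] pr_id pr_W)
  have "inj T"
    unfolding linear_injective_0[OF T_lin]
  proof (intro allI impI)
    fix x assume Tx: "T x = 0"
    have "pr x \<bullet> (Sig *v pr x) = pr x \<bullet> pr (Sig *v pr x)" by (rule pr_inner[OF pr_W, symmetric])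
    also have "\<dots> = 0" using pr_T[of x] Tx by (simp add: linear_0[OF pr_lin])
    finally have "pr x = 0" by (rule pos_def_quadratic_eq_0)
    then show "x = 0" using Tx by (simp add: T_def linear_0[OF pr_lin])
  qed
  then obtain g where g: "linear g" "\<And>x. g (T x) = x" "\<And>x. T (g x) = x"
    using linear_injective_isomorphism[OF T_lin] by blast
  have g_W: "g w \<in> W" if "w \<in> W" for w
  proof -
    have "pr (Sig *v pr (g w)) + (g w - pr (g w)) = w" using g(3)[of w] by (simp add: T_def)
    then have "g w = w - pr (Sig *v pr (g w)) + pr (g w)" by (simp add: algebra_simps)
    also have "\<dots> \<in> W" using that pr_W unfolding basis_span[symmetric]
      by (intro span_add span_diff)
    finally show ?thesis .
  qed
  define H where "H l j = U l \<bullet> g (U j)" for l j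
  have "(\<Sum>l<k. gram i l * H l j) = (if i = j then 1 else 0)" if "i < k" "j < k" for i j
  proof -
    have "(\<Sum>l<k. gram i l * H l j) = U i \<bullet> (Sig *v pr (g (U j)))"
      unfolding H_def pr_def
      by (simp add: linear_sum[OF matrix_vector_mul_linear] matrix_vector_mult_scaleR inner_sum_right mult.commute)
    also have "\<dots> = U i \<bullet> T (g (U j))"
      using U_pr[OF that(1)] g_W[OF basis_mem[OF that(2)]] by (simp add: T_def pr_id)
    finally show ?thesis using g(3) basis_inner that by simp
  qed
  moreover have "(\<Sum>l<k. H i l * gram l j) = (if i = j then 1 else 0)" if "i < k" "j < k" for i j
  proof -
    have "(\<Sum>l<k. H i l * gram l j) = U i \<bullet> g (pr (Sig *v U j))"
      unfolding H_def pr_def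
      by (simp add: linear_sum[OF g(1)] linear_cmul[OF g(1)] inner_sum_right mult.commute)
    also have "pr (Sig *v U j) = T (U j)"
      using basis_mem[OF that(2)] by (simp add: T_def pr_id)
    finally show ?thesis using g(2) basis_inner that by simp
  qed
  ultimately show ?thesis by (intro exI[of _ H] allI impI conjI)
qed

lemma sq_inv_gram:
  assumes "i < k" "j < k"
  shows "(\<Sum>l<k. gram i l * sq_inv k gram l j) = (if i = j then 1 else 0)"
proof -
  have "\<forall>i<k. \<forall>j<k. (\<Sum>l<k. gram i l * sq_inv k gram l j) = (if i = j then 1 else 0) \<and>
     (\<Sum>l<k. sq_inv k gram i l * gram l j) = (if i = j then 1 else 0)"
    unfolding sq_inv_def by (rule someI_ex[OF gram_inverse_exists])
  then show ?thesis using assms by blast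
qed

lemma basis_inner_lift_col:
  assumes "i < k" "j < k" shows "U i \<bullet> lift_col Sig k U j = (if i = j then 1 else 0)"
  using sq_inv_gram[OF assms]
  by (simp add: lift_col_def inner_sum_right mult.commute)

lemma basis_inner_lift_map:
  assumes "i < k" shows "U i \<bullet> lift_map Sig k U y = y i"
proof -
  have "U i \<bullet> lift_map Sig k U y = (\<Sum>j<k. if j = i then y j else 0)"
    unfolding lift_map_def inner_sum_right
    by (rule sum.cong) (use assms basis_inner_lift_col[OF assms] in auto)
  then show ?thesis using assms by simp
qed

lemma lift_map_in_image: "\<exists>w\<in>W. lift_map Sig k U y = Sig *v w"
proof
  define w where "w = (\<Sum>j<k. y j *\<^sub>R (\<Sum>i<k. sq_inv k gram i j *\<^sub>R U i))"
  show "w \<in> W" unfolding w_def basis_span[symmetric]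
    by (intro span_sum span_scale span_base) auto
  show "lift_map Sig k U y = Sig *v w"
    by (simp add: lift_map_def lift_col_def w_def linear_sum[OF matrix_vector_mul_linear]
      matrix_vector_mult_scaleR)
qed

text \<open>This is \<open>U\<^sup>T L = 1\<close>, extended from the basis to its span.\<close>
lemma compressed_inner:
  assumes "q \<in> W"
  shows "q \<bullet> lift_map Sig k U (\<lambda>i. U i \<bullet> v) = q \<bullet> v"
  by (rule inner_eq_on_span) (simp_all add: basis_inner_lift_map assms)

text \<open>With \<open>c - c\<^sub>0 = \<Sigma> v\<close> and compression \<open>c\<^sub>0 + \<Sigma> w\<close> with \<open>w \<in> W\<close>, orthogonality gives
  \<open>w \<bullet> \<Sigma> w = w \<bullet> \<Sigma> v\<close>, and expanding \<open>0 \<le> (v - w) \<bullet> \<Sigma> (v - w)\<close> shows that the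
  Mahalanobis norm does not grow.\<close>
lemma compressed_in_ellipsoid:
  assumes "c \<in> ellipsoid c0 Sig"
  shows "c0 + lift_map Sig k U (\<lambda>i. U i \<bullet> (c - c0)) \<in> ellipsoid c0 Sig"
proof -
  define v where "v = matrix_inv Sig *v (c - c0)"
  have c: "c - c0 = Sig *v v" by (simp add: v_def pos_def_matrix_inv)
  obtain w where w: "w \<in> W" "lift_map Sig k U (\<lambda>i. U i \<bullet> (c - c0)) = Sig *v w"
    using lift_map_in_image by blast
  have wv: "w \<bullet> (Sig *v w) = w \<bullet> (Sig *v v)"
  proof -
    have "w \<bullet> (Sig *v w) = w \<bullet> (c - c0)"
      using compressed_inner[OF w(1), of "c - c0"] by (simp only: w(2))
    then show ?thesis by (simp only: c)
  qed
  have "0 \<le> (v - w) \<bullet> (Sig *v (v - w))" by (rule pos_def_quadratic_nonneg)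
  also have "\<dots> = v \<bullet> (Sig *v v) - v \<bullet> (Sig *v w) - w \<bullet> (Sig *v v) + w \<bullet> (Sig *v w)"
    by (simp add: matrix_vector_mult_diff_distrib inner_diff_left inner_diff_right)
  also have "v \<bullet> (Sig *v w) = w \<bullet> (Sig *v v)"
    using pos_def_symmetric[of v w] by (simp add: inner_commute)
  finally have "w \<bullet> (Sig *v w) \<le> v \<bullet> (Sig *v v)" using wv by linarith
  also have "\<dots> \<le> 1" using assms by (simp add: ellipsoid_def c pos_def_matrix_inv inner_commute)
  finally show ?thesis by (simp add: ellipsoid_def w(2) pos_def_matrix_inv inner_commute)
qed

end
end

definition outer :: "real ^ 'd \<Rightarrow> real ^ 'p \<Rightarrow> real ^ 'p ^ 'd" where
  "outer a x = (\<chi> r. a $ r *\<^sub>R x)"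

lemma outer_mult: "outer a x *v \<xi> = (x \<bullet> \<xi>) *\<^sub>R a"
  by (simp add: outer_def vec_eq_iff matrix_vector_mult_def inner_vec_def sum_distrib_left sum_distrib_right mult_ac)

lemma linear_outer: "linear (outer a)"
  by (rule linearI) (simp_all add: outer_def vec_eq_iff algebra_simps)

text \<open>The matrices \<open>L B\<close>, where \<open>B\<close> has \<open>k\<close> rows: a fixed type of matrices that contains the
  parameters for every \<open>k\<close>, with \<open>k p\<close> generators.\<close>
definition lift_space :: "real ^ 'd ^ 'd \<Rightarrow> nat \<Rightarrow> (nat \<Rightarrow> real ^ 'd) \<Rightarrow> (real ^ 'p ^ 'd) set" where
  "lift_space Sig k U = span ((\<lambda>(j, b). outer (lift_col Sig k U j) b) ` ({..<k} \<times> Basis))"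

lemma dim_lift_space: "dim (lift_space Sig k U :: (real ^ 'p ^ 'd) set) \<le> k * CARD('p)"
proof -
  let ?B = "(\<lambda>(j, b). outer (lift_col Sig k U j) b) ` ({..<k} \<times> (Basis :: (real ^ 'p) set))"
  have "dim (lift_space Sig k U :: (real ^ 'p ^ 'd) set) \<le> card ?B"
    unfolding lift_space_def by (simp add: dim_le_card')
  also have "\<dots> \<le> card ({..<k} \<times> (Basis :: (real ^ 'p) set))" by (rule card_image_le) simp
  finally show ?thesis by (simp add: card_cartesian_product)
qed

lemma compressed_class_eq_lift_space:
  fixes f :: "real ^ 'p \<Rightarrow> real ^ 'd"
  assumes "f \<in> compressed_class c0 Sig k U"
  obtains A where "A \<in> lift_space Sig k U" "f = (\<lambda>\<xi>. c0 + A *v \<xi>)"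
proof -
  obtain B where f: "f = (\<lambda>\<xi>. c0 + lift_map Sig k U (\<lambda>i. B i \<bullet> \<xi>))"
    using assms by (auto simp: compressed_class_def)
  define A where "A = (\<Sum>j<k. outer (lift_col Sig k U j) (B j))"
  have "outer (lift_col Sig k U j) (B j) \<in> lift_space Sig k U" if "j < k" for j
  proof -
    have "outer (lift_col Sig k U j) (B j) = outer (lift_col Sig k U j) (\<Sum>b\<in>Basis. (B j \<bullet> b) *\<^sub>R b)"
      by (simp add: euclidean_representation)
    also have "\<dots> = (\<Sum>b\<in>Basis. (B j \<bullet> b) *\<^sub>R outer (lift_col Sig k U j) b)"
      by (simp add: linear_sum[OF linear_outer] linear_cmul[OF linear_outer])
    also have "\<dots> \<in> lift_space Sig k U" unfolding lift_space_def
      using that by (intro span_sum span_scale span_base) force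
    finally show ?thesis .
  qed
  then have "A \<in> lift_space Sig k U" unfolding A_def lift_space_def by (intro span_sum) auto
  moreover have "A *v \<xi> = lift_map Sig k U (\<lambda>i. B i \<bullet> \<xi>)" for \<xi>
  proof -
    have "linear (\<lambda>A :: real ^ 'p ^ 'd. A *v \<xi>)"
      by (rule linearI) (simp_all add: matrix_vector_mult_add_rdistrib scaleR_matrix_vector_assoc)
    from linear_sum[OF this, of "\<lambda>j. outer (lift_col Sig k U j) (B j)" "{..<k}"]
    show ?thesis by (simp add: A_def lift_map_def outer_mult)
  qed
  ultimately show ?thesis using that f by auto
qed

lemma compress_full_class:
  assumes "f \<in> full_class c0" shows "compress c0 Sig k U f \<in> compressed_class c0 Sig k U"
proof -
  obtain A where f: "f = (\<lambda>\<xi>. c0 + A *v \<xi>)" using assms by (auto simp: full_class_def)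
  have "U i \<bullet> (A *v \<xi>) = (U i v* A) \<bullet> \<xi>" for i \<xi> by (simp add: dot_lmul_matrix)
  then show ?thesis unfolding compressed_class_def compress_def f
    by (auto intro!: exI[of _ "\<lambda>i. U i v* A"])
qed

lemma compressed_class_subset_full_class: "compressed_class c0 Sig k U \<subseteq> full_class c0"
proof
  fix f assume "f \<in> compressed_class c0 Sig k U"
  then obtain A where "f = (\<lambda>\<xi>. c0 + A *v \<xi>)" by (rule compressed_class_eq_lift_space)
  then show "f \<in> full_class c0" unfolding full_class_def by blast
qed

section \<open>Compression without loss and the generalization bound\<close>

theorem theorem28:
  fixes X :: "(real ^ 'd) set"
    and xs :: "real ^ 'd \<Rightarrow> real ^ 'd"
    and c0 :: "real ^ 'd"
    and Sig :: "real ^ 'd ^ 'd"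
    and C :: "(real ^ 'd) set"
    and P :: "((real ^ 'p) \<times> (real ^ 'd)) measure"
    and \<Xi> :: "(real ^ 'p) set"
    and D :: "(real ^ 'd) list"
    and W :: "(real ^ 'd) set"
    and k :: nat
    and U :: "nat \<Rightarrow> real ^ 'd"
  assumes "polytope X" and "X \<noteq> {}"
    and "lp_oracle X xs"
    and "pos_def Sig"
    and C_def: "C = ellipsoid c0 Sig"
    and "prob_space P" and "sets P = sets borel"
    and "AE z in P. fst z \<in> \<Xi>"
    and "AE z in P. snd z \<in> C"
    and "min_suff_dataset X C D"
    and W_def: "W = span (set D)"
    and k_def: "k = dim W"
    and "orthonormal_basis k U W"
  shows
    "(\<forall>f \<in> argmin_on (spo_risk xs P) (feasible_in P C (full_class c0)).
        compress c0 Sig k U f \<in> feasible_in P C (compressed_class c0 Sig k U) \<and>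
        compress c0 Sig k U f
          \<in> argmin_on (spo_risk xs P) (feasible_in P C (compressed_class c0 Sig k U)) \<and>
        spo_risk xs P f = spo_risk xs P (compress c0 Sig k U f)) \<and>
     (\<forall>n \<delta>. 1 \<le> n \<longrightarrow> 0 < \<delta> \<longrightarrow> \<delta> < 1 \<longrightarrow>
        with_prob_ge (Pi\<^sub>M {..<n} (\<lambda>_. P)) (1 - \<delta>)
          (\<lambda>S. \<forall>f \<in> compressed_class c0 Sig k U.
             spo_risk xs P f
               \<le> emp_spo_risk xs n S f
                 + 2 * lp_range X C *
                   sqrt (2 * real (k * CARD('p) + 1)
                         * ln (real n * (real (card (extreme_points X)))\<^sup>2) / real n)
                 + lp_range X C * sqrt (ln (1 / \<delta>) / (2 * real n))))"
proof -
  have compact_C: "compact C" unfolding C_def using \<open>pos_def Sig\<close> by (rule compact_ellipsoid)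
  interpret spo_linear_class X xs P C "lift_space Sig k U" "k * CARD('p)" c0
    unfolding spo_linear_class_def spo_linear_class_axioms_def lp_oracle_on_polytope_def
    using assms compact_C dim_lift_space by (auto simp: lift_space_def)
  note U = \<open>orthonormal_basis k U W\<close>
  let ?compress = "compress c0 Sig k U :: (real ^ 'p \<Rightarrow> real ^ 'd) \<Rightarrow> _"
  let ?full = "feasible_in P C (full_class c0)"
  let ?compressed = "feasible_in P C (compressed_class c0 Sig k U)"
  have same_decision: "xs (c0 + lift_map Sig k U (\<lambda>i. U i \<bullet> (c - c0))) = xs c"
    if c: "c \<in> C" for c
  proof (rule oracle_cong_argmin)
    define c' where "c' = c0 + lift_map Sig k U (\<lambda>i. U i \<bullet> (c - c0))"
    have c': "c' \<in> C"
      using compressed_in_ellipsoid[OF \<open>pos_def Sig\<close> U] c by (simp add: c'_def C_def)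
    have "suff_dataset X C D"
      using \<open>min_suff_dataset X C D\<close> by (simp add: min_suff_dataset_def is_arg_min_def)
    then obtain Xhat where Xhat: "\<forall>c\<in>C. Xhat (map (\<lambda>q. c \<bullet> q) D) = lin_argmin X c"
      unfolding suff_dataset_def by blast
    have "c' \<bullet> q = c \<bullet> q" if "q \<in> set D" for q
    proof -
      have "q \<in> W" using that by (simp add: W_def span_base)
      then have "q \<bullet> c' = q \<bullet> c0 + q \<bullet> (c - c0)"
        unfolding c'_def inner_add_right using compressed_inner[OF \<open>pos_def Sig\<close> U] by simp
      then show ?thesis by (simp add: inner_diff_right inner_commute)
    qed
    then have "map (\<lambda>q. c' \<bullet> q) D = map (\<lambda>q. c \<bullet> q) D" by simp
    then show "lin_argmin X c' = lin_argmin X c" using Xhat c' c by metis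
  qed
  have part1: "?compress f \<in> ?compressed \<and>
      ?compress f \<in> argmin_on (spo_risk xs P) ?compressed \<and>
      spo_risk xs P f = spo_risk xs P (?compress f)"
    if f: "f \<in> argmin_on (spo_risk xs P) ?full" for f
  proof -
    have f_full: "f \<in> full_class c0" and f_C: "AE z in P. f (fst z) \<in> C"
      and f_min: "\<And>g. g \<in> ?full \<Longrightarrow> \<not> spo_risk xs P g < spo_risk xs P f"
      using f by (auto simp: argmin_on_def is_arg_min_def feasible_in_def)
    have cf: "?compress f \<in> compressed_class c0 Sig k U" using f_full by (rule compress_full_class)
    obtain A where A: "f = (\<lambda>\<xi>. c0 + A *v \<xi>)" using f_full by (auto simp: full_class_def)
    obtain A' where A': "?compress f = (\<lambda>\<xi>. c0 + A' *v \<xi>)"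
      using cf by (rule compressed_class_eq_lift_space)
    have "AE z in P. ?compress f (fst z) \<in> C"
      using f_C
    proof eventually_elim
      case (elim z)
      then show ?case
        using compressed_in_ellipsoid[OF \<open>pos_def Sig\<close> U, of "f (fst z)" c0]
        by (simp add: compress_def C_def)
    qed
    then have feasible: "?compress f \<in> ?compressed" using cf by (simp add: feasible_in_def)
    have risk: "spo_risk xs P f = spo_risk xs P (?compress f)"
      unfolding spo_risk_def
    proof (rule integral_cong_AE)
      show "(\<lambda>z. spo_loss xs (f (fst z)) (snd z)) \<in> borel_measurable P"
        unfolding A by (rule measurable_spo_loss)
      show "(\<lambda>z. spo_loss xs (?compress f (fst z)) (snd z)) \<in> borel_measurable P"
        unfolding A' by (rule measurable_spo_loss)
      show "AE z in P. spo_loss xs (f (fst z)) (snd z) = spo_loss xs (?compress f (fst z)) (snd z)"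
        using f_C
      proof eventually_elim
        case (elim z)
        then show ?case by (simp add: spo_loss_def compress_def same_decision)
      qed
    qed
    have "?compressed \<subseteq> ?full"
      using compressed_class_subset_full_class[of c0 Sig k U] by (auto simp: feasible_in_def)
    then have "\<not> spo_risk xs P g < spo_risk xs P (?compress f)" if "g \<in> ?compressed" for g
      using f_min[of g] that risk by auto
    then have "?compress f \<in> argmin_on (spo_risk xs P) ?compressed"
      using feasible by (auto simp: argmin_on_def is_arg_min_def)
    then show ?thesis using feasible risk by blast
  qed
  have part2: "with_prob_ge (Pi\<^sub>M {..<n} (\<lambda>_. P)) (1 - \<delta>)
      (\<lambda>S. \<forall>f \<in> compressed_class c0 Sig k U. spo_risk xs P f \<le> emp_spo_risk xs n S f
        + 2 * lp_range X C * sqrt (2 * real (k * CARD('p) + 1)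
            * ln (real n * (real (card (extreme_points X)))\<^sup>2) / real n)
        + lp_range X C * sqrt (ln (1 / \<delta>) / (2 * real n)))"
    if "1 \<le> n" "0 < \<delta>" "\<delta> < 1" for n :: nat and \<delta> :: real
  proof (rule with_prob_ge_AE_mono[OF spo_generalization_bound[OF that]], rule AE_I2, intro impI ballI)
    fix S and f :: "real ^ 'p \<Rightarrow> real ^ 'd"
    assume bound: "\<forall>A\<in>lift_space Sig k U. spo_risk xs P (\<lambda>\<xi>. c0 + A *v \<xi>)
        \<le> emp_spo_risk xs n S (\<lambda>\<xi>. c0 + A *v \<xi>)
        + 2 * lp_range X C * sqrt (2 * real (k * CARD('p) + 1)
            * ln (real n * (real (card (extreme_points X)))\<^sup>2) / real n)
        + lp_range X C * sqrt (ln (1 / \<delta>) / (2 * real n))"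
      and "f \<in> compressed_class c0 Sig k U"
    from this(2) obtain A where A: "A \<in> lift_space Sig k U" "f = (\<lambda>\<xi>. c0 + A *v \<xi>)"
      by (rule compressed_class_eq_lift_space)
    show "spo_risk xs P f \<le> emp_spo_risk xs n S f
        + 2 * lp_range X C * sqrt (2 * real (k * CARD('p) + 1)
            * ln (real n * (real (card (extreme_points X)))\<^sup>2) / real n)
        + lp_range X C * sqrt (ln (1 / \<delta>) / (2 * real n))"
      unfolding A(2) using bound A(1) by (rule bspec)
  qed
  show ?thesis by (rule conjI, rule ballI, erule part1, intro allI impI, rule part2)
qed

end
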